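(* Let $1<p<\infty$, let $Q_0\subset\mathbb{R}^n$ be a cube and assume that $f\in L^1(Q_0)\setminus L\log^+L(Q_0)$. Then $(M^d_{Q_0}f)^{\frac1p}\in JN^d_p(Q_0)\setminus L^p(Q_0)$.
   Context: $|A|$ denotes Lebesgue measure and $f_A=\frac1{|A|}\int_A f\,dx$ the integral average. A cube in $\mathbb{R}^n$ is a closed bounded cube $[a_1,b_1]\times\dots\times[a_n,b_n]$ with sides parallel to the coordinate axes and $b_1-a_1=\dots=b_n-a_n>0$. Dyadic subcubes: for a cube $Q_0$, $\mathcal{D}(Q_0)=\bigcup_{j=0}^\infty \mathcal{D}_j(Q_0)$, where $\mathcal{D}_j(Q_0)$ consists of the $2^{jn}$ closed cubes of side length $2^{-j}l(Q_0)$ ($l(Q_0)$ being the side length of $Q_0$), with pairwise disjoint interiors, obtained by dividing each side of $Q_0$ into $2^j$ equal parts. Elements of $\mathcal{D}(Q_0)$ are the dyadic subcubes of $Q_0$. Collections of dyadic cubes are called pairwise disjoint if their interiors are pairwise disjoint. Dyadic John--Nirenberg space: for $1<p<\infty$, a function $f\in L^1(Q_0)$ belongs to $JN^d_p(Q_0)$ if \[ \|f\|_{JN^d_{p}(Q_0)}^p=\sup\sum_{i}|Q_i|\Bigl(\frac1{|Q_i|}\int_{Q_i}|f-f_{Q_i}|\,dx\Bigr)^p<\infty, \] where the supremum is taken over countable collections $\{Q_i\}$ of pairwise disjoint dyadic subcubes of $Q_0$. Dyadic maximal function: for $f\in L^1(Q_0)$ and $x\in Q_0$, \[ M^d_{Q_0}f(x)=\sup\frac1{|Q|}\int_Q|f(y)|\,dy,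 \] where the supremum is taken over all $Q\in\mathcal{D}(Q_0)$ with $x\in Q$. $L\log^+L(Q_0)$ is the set of measurable functions $f$ on $Q_0$ with $\int_{Q_0}|f|\log^+|f|\,dx<\infty$, where $\log^+ t=\max\{\log t,0\}$. *)

theory Defs
  imports "HOL-Analysis.Analysis"
begin

definition cube :: "(real ^ 'n) set \<Rightarrow> bool" where
  "cube Q \<longleftrightarrow> (\<exists>a l. 0 < l \<and> Q = cbox a (\<chi> i. a $ i + l))"

text \<open>
  The corner \<open>a\<close> and the side length \<open>l\<close> are determined by the cube \<open>Q\<^sub>0\<close>, so
  the existential quantification over them is harmless.
  The function \<open>k\<close> enumerates the \<open>2\<^bsup>jn\<^esup>\<close> grid positions.
\<close>

definition dyadic_level :: "nat \<Rightarrow> (real ^ 'n) set \<Rightarrow> (real ^ 'n) set set" where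
  "dyadic_level j Q\<^sub>0 =
     {cbox (\<chi> i. a $ i + real (k i) * (l / 2 ^ j)) (\<chi> i. a $ i + (real (k i) + 1) * (l / 2 ^ j))
      | a l k. 0 < l \<and> Q\<^sub>0 = cbox a (\<chi> i. a $ i + l) \<and> (\<forall>i. k i < 2 ^ j)}"

definition dyadic_subcubes :: "(real ^ 'n) set \<Rightarrow> (real ^ 'n) set set" where
  "dyadic_subcubes Q\<^sub>0 = (\<Union>j. dyadic_level j Q\<^sub>0)"

definition average :: "(real ^ 'n) set \<Rightarrow> (real ^ 'n \<Rightarrow> real) \<Rightarrow> real" where
  "average A f = (1 / measure lebesgue A) * (LINT x|lebesgue_on A. f x)"

definition L1_space :: "(real ^ 'n) set \<Rightarrow> (real ^ 'n \<Rightarrow> real) set" where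
  "L1_space Q\<^sub>0 = {f. integrable (lebesgue_on Q\<^sub>0) f}"

definition Lp_space :: "real \<Rightarrow> (real ^ 'n) set \<Rightarrow> (real ^ 'n \<Rightarrow> real) set" where
  "Lp_space p Q\<^sub>0 =
     {f \<in> borel_measurable (lebesgue_on Q\<^sub>0).
        (\<integral>\<^sup>+x. ennreal (\<bar>f x\<bar> powr p) \<partial>lebesgue_on Q\<^sub>0) < \<infinity>}"

text \<open>At zeros of \<open>f\<close> the integrand below is \<open>0\<close>, whatever the value of \<open>ln 0\<close>.\<close>

definition LlogL_space :: "(real ^ 'n) set \<Rightarrow> (real ^ 'n \<Rightarrow> real) set" where
  "LlogL_space Q\<^sub>0 =
     {f \<in> borel_measurable (lebesgue_on Q\<^sub>0).
        (\<integral>\<^sup>+x. ennreal (\<bar>f x\<bar> * max (ln \<bar>f x\<bar>) 0) \<partial>lebesgue_on Q\<^sub>0) < \<infinity>}"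

text \<open>
  The \<open>p\<close>-th power of the dyadic John--Nirenberg norm, possibly infinite.
  A family of cubes with pairwise disjoint interiors has no repetitions, so
  it can be given as a set of cubes.
\<close>

definition JNd_norm_pow :: "real \<Rightarrow> (real ^ 'n) set \<Rightarrow> (real ^ 'n \<Rightarrow> real) \<Rightarrow> ennreal" where
  "JNd_norm_pow p Q\<^sub>0 f =
     (SUP \<F> \<in> {\<F>. \<F> \<subseteq> dyadic_subcubes Q\<^sub>0 \<and> countable \<F> \<and>
                  pairwise (\<lambda>A B. interior A \<inter> interior B = {}) \<F>}.
        \<Sum>\<^sub>\<infinity>Q\<in>\<F>. ennreal (measure lebesgue Q * average Q (\<lambda>x. \<bar>f x - average Q f\<bar>) powr p))"

definition JNd_space :: "real \<Rightarrow> (real ^ 'n) set \<Rightarrow> (real ^ 'n \<Rightarrow> real) set" where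
  "JNd_space p Q\<^sub>0 = {f \<in> L1_space Q\<^sub>0. JNd_norm_pow p Q\<^sub>0 f < \<infinity>}"

text \<open>The supremum may be infinite at some points even if \<open>f\<close> is integrable.\<close>

definition dyadic_maximal ::
  "(real ^ 'n) set \<Rightarrow> (real ^ 'n \<Rightarrow> real) \<Rightarrow> real ^ 'n \<Rightarrow> ennreal" where
  "dyadic_maximal Q\<^sub>0 f x =
     (SUP Q \<in> {Q \<in> dyadic_subcubes Q\<^sub>0. x \<in> Q}. ennreal (average Q (\<lambda>y. \<bar>f y\<bar>)))"

end

theory Submission
  imports Defs
begin

text \<open>
  On a dyadic cube \<open>Q\<close>, the maximal function \<open>M\<close> of \<open>f\<close> is, off the cube boundaries, the maximum
  of a constant (coming from the ancestors of \<open>Q\<close>) and the maximal function of \<open>f\<close> localised to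
  \<open>Q\<close>. Hence \<open>M\<^bsup>1/p\<^esup>\<close> differs from a constant on \<open>Q\<close> by at most the localised maximal function to
  the power \<open>1/p\<close>, and the weak type estimate (in the form of Kolmogorov's inequality) bounds
  the \<open>p\<close>-th power of the mean oscillation of \<open>M\<^bsup>1/p\<^esup>\<close> over \<open>Q\<close> by a multiple of the mean of \<open>\<bar>f\<bar>\<close>;
  these bounds add up over disjoint cubes. Conversely, the reverse weak type
  estimate \<open>\<integral>\<^bsub>{\<bar>f\<bar> > c}\<^esub> \<bar>f\<bar> \<le> 2\<^sup>n c \<bar>{M > c}\<bar>\<close> for large \<open>c\<close>, summed over \<open>c = 2\<^sup>k a\<close>, shows that
  integrability of \<open>M\<close> forces \<open>f \<in> L log\<^sup>+ L\<close> (Stein).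
\<close>

section \<open>Families of dyadic type\<close>

lemma lebesgue_open: "open S \<Longrightarrow> S \<in> sets lebesgue"
  by (metis borel_open sets_completionI_sets sets_lborel)

text \<open>Nestedness and finiteness of ancestors yield disjoint maximal cubes,
  \<open>parent\<close> is the doubling step of stopping arguments, and \<open>fine\<close> provides
  small cubes inside open sets. The dyadic subcubes satisfy all this with \<open>C\<close> equal to
  2 to the power of the dimension.\<close>

locale dyadic_family =
  fixes D :: "'a::euclidean_space set set" and Q\<^sub>0 :: "'a set" and C :: real
  assumes countable_D: "countable D"
    and doubling_nonneg: "0 \<le> C"
    and top_in_D: "Q\<^sub>0 \<in> D"
    and subset_top: "A \<in> D \<Longrightarrow> A \<subseteq> Q\<^sub>0"
    and compact_D: "A \<in> D \<Longrightarrow> compact A"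
    and measure_pos: "A \<in> D \<Longrightarrow> 0 < measure lebesgue A"
    and negligible_frontier_D: "A \<in> D \<Longrightarrow> negligible (frontier A)"
    and nested: "A \<in> D \<Longrightarrow> B \<in> D \<Longrightarrow> A \<subseteq> B \<or> B \<subseteq> A \<or> interior A \<inter> interior B = {}"
    and finite_ancestors: "A \<in> D \<Longrightarrow> finite {B \<in> D. A \<subseteq> B}"
    and parent: "A \<in> D \<Longrightarrow> A \<noteq> Q\<^sub>0 \<Longrightarrow> \<exists>B\<in>D. A \<subset> B \<and> measure lebesgue B \<le> C * measure lebesgue A"
    and fine: "open U \<Longrightarrow> x \<in> U \<Longrightarrow> x \<in> Q\<^sub>0 \<Longrightarrow> \<exists>A\<in>D. x \<in> A \<and> A \<subseteq> U"
begin

lemma lmeasurable_D: "A \<in> D \<Longrightarrow> A \<in> lmeasurable"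
  by (rule lmeasurable_compact[OF compact_D])

lemma sets_D: "A \<in> D \<Longrightarrow> A \<in> sets lebesgue"
  using lmeasurable_D by blast

lemma emeasure_D: "A \<in> D \<Longrightarrow> emeasure lebesgue A = ennreal (measure lebesgue A)"
  using emeasure_eq_measure2 lmeasurable_D by blast

lemma sets_Union: "\<G> \<subseteq> D \<Longrightarrow> \<Union>\<G> \<in> sets lebesgue"
  using countable_D sets_D by (meson countable_subset sets.countable_Union subset_iff)

text \<open>Closed dyadic cubes overlap on their boundaries; off this null set, dyadic cubes with a common point are nested.\<close>

definition skeleton :: "'a set" where
  "skeleton = (\<Union>A\<in>D. frontier A)"

lemma skeleton_null: "skeleton \<in> null_sets lebesgue"
  unfolding skeleton_def
  by (intro null_sets_UN' countable_D) (use negligible_frontier_D in \<open>auto simp: negligible_iff_null_sets\<close>)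

lemma mem_interior: "A \<in> D \<Longrightarrow> x \<in> A \<Longrightarrow> x \<notin> skeleton \<Longrightarrow> x \<in> interior A"
  unfolding skeleton_def frontier_def using closure_subset by fastforce

text \<open>For a family of cubes selected by a lower bound on means, these are the Calderon-Zygmund
  stopping cubes.\<close>

definition maximals :: "'a set set \<Rightarrow> 'a set set" where
  "maximals \<G> = {A \<in> \<G>. \<forall>B\<in>\<G>. A \<subseteq> B \<longrightarrow> A = B}"

text \<open>A member has only finitely many ancestors, so an inclusion-maximal member of
  \<open>\<G>\<close> lies above it.\<close>

lemma Union_maximals:
  assumes "\<G> \<subseteq> D"
  shows "\<Union>(maximals \<G>) = \<Union>\<G>"
proof -
  have "\<exists>B\<in>maximals \<G>. A \<subseteq> B" if "A \<in> \<G>" for A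
  proof -
    have "finite {B \<in> \<G>. A \<subseteq> B}"
      by (rule finite_subset[OF _ finite_ancestors[of A]]) (use that assms in auto)
    from finite_has_maximal2[OF this, of A] that show ?thesis
      unfolding maximals_def by fastforce
  qed
  then show ?thesis
    unfolding maximals_def by blast
qed

lemma disjoint_maximals:
  assumes "\<G> \<subseteq> D"
  shows "disjoint_family_on interior (maximals \<G>)"
proof (unfold disjoint_family_on_def, intro ballI impI)
  fix A B assume AB: "A \<in> maximals \<G>" "B \<in> maximals \<G>" "A \<noteq> B"
  then have "A \<in> D" "B \<in> D" "\<not> A \<subseteq> B" "\<not> B \<subseteq> A"
    using assms unfolding maximals_def by auto
  then show "interior A \<inter> interior B = {}"
    using nested by auto
qed

text \<open>The two sets differ only inside \<open>skeleton\<close>, which absolute continuity makes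
  null for \<alpha>. Interiors are disjoint while closed cubes cover; this passes between the
  two.\<close>

lemma emeasure_interior_Union:
  assumes "\<G> \<subseteq> D" "sets \<alpha> = sets lebesgue" "absolutely_continuous lebesgue \<alpha>"
  shows "emeasure \<alpha> (\<Union>A\<in>\<G>. interior A) = emeasure \<alpha> (\<Union>\<G>)"
proof (rule emeasure_eq_AE)
  have "AE x in \<alpha>. x \<notin> skeleton"
    using skeleton_null assms(3) unfolding absolutely_continuous_def by (intro AE_not_in) auto
  then show "AE x in \<alpha>. (x \<in> (\<Union>A\<in>\<G>. interior A)) = (x \<in> \<Union>\<G>)"
  proof eventually_elim
    case (elim x)
    then have "x \<in> interior A \<longleftrightarrow> x \<in> A" if "A \<in> \<G>" for A
      using that mem_interior[of A x] assms(1) interior_subset[of A] by blast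
    then show ?case by blast
  qed
  show "(\<Union>A\<in>\<G>. interior A) \<in> sets \<alpha>"
    unfolding assms(2) by (rule lebesgue_open) (intro open_UN ballI open_interior)
  show "\<Union>\<G> \<in> sets \<alpha>" using sets_Union[OF assms(1)] assms(2) by simp
qed

text \<open>Each measure of the union is a sum over the maximal members, whose interiors are
  disjoint, so a comparison cube by cube adds up. The weak type estimate, its converse and the
  differentiation argument are all instances.\<close>

lemma emeasure_Union_le:
  assumes \<G>: "\<G> \<subseteq> D"
    and \<alpha>: "sets \<alpha> = sets lebesgue" "absolutely_continuous lebesgue \<alpha>"
    and \<beta>: "sets \<beta> = sets lebesgue" "absolutely_continuous lebesgue \<beta>"
    and le: "\<And>A. A \<in> maximals \<G> \<Longrightarrow> emeasure \<alpha> A \<le> c * emeasure \<beta> A"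
  shows "emeasure \<alpha> (\<Union>\<G>) \<le> c * emeasure \<beta> (\<Union>\<G>)"
proof -
  let ?M = "maximals \<G>"
  have M: "?M \<subseteq> D" using \<G> by (auto simp: maximals_def)
  have cM: "countable ?M" using countable_subset[OF M countable_D] .
  have eq: "emeasure \<gamma> (\<Union>\<G>) = (\<integral>\<^sup>+A. emeasure \<gamma> A \<partial>count_space ?M)"
    if \<gamma>: "sets \<gamma> = sets lebesgue" "absolutely_continuous lebesgue \<gamma>" for \<gamma>
  proof -
    have "emeasure \<gamma> (\<Union>\<G>) = emeasure \<gamma> (\<Union>A\<in>?M. interior A)"
      using emeasure_interior_Union[OF M \<gamma>] Union_maximals[OF \<G>] by simp
    also have "\<dots> = (\<integral>\<^sup>+A. emeasure \<gamma> (interior A) \<partial>count_space ?M)"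
    proof (rule emeasure_UN_countable[OF _ cM disjoint_maximals[OF \<G>]])
      show "interior A \<in> sets \<gamma>" for A
        unfolding \<gamma>(1) by (rule lebesgue_open) (rule open_interior)
    qed
    also have "\<dots> = (\<integral>\<^sup>+A. emeasure \<gamma> A \<partial>count_space ?M)"
    proof (rule nn_integral_cong)
      fix A assume "A \<in> space (count_space ?M)"
      then show "emeasure \<gamma> (interior A) = emeasure \<gamma> A"
        using emeasure_interior_Union[of "{A}", OF _ \<gamma>] M by (simp add: subset_iff)
    qed
    finally show ?thesis .
  qed
  have "(\<integral>\<^sup>+A. emeasure \<alpha> A \<partial>count_space ?M) \<le> (\<integral>\<^sup>+A. c * emeasure \<beta> A \<partial>count_space ?M)"
    by (rule nn_integral_mono) (simp add: le)
  also have "\<dots> = c * (\<integral>\<^sup>+A. emeasure \<beta> A \<partial>count_space ?M)"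
    by (rule nn_integral_cmult) simp
  finally show ?thesis using eq[OF \<alpha>] eq[OF \<beta>] by simp
qed

end

section \<open>The maximal function of a weight\<close>

text \<open>The weight stands for \<bar>f\<bar> extended by zero, so that integrals over the whole
  space can be used throughout.\<close>

locale dyadic_weight = dyadic_family D Q\<^sub>0 C
  for D :: "'a::euclidean_space set set" and Q\<^sub>0 C +
  fixes w :: "'a \<Rightarrow> real"
  assumes weight_nonneg: "0 \<le> w x"
    and weight_integrable: "integrable lebesgue w"
    and weight_outside: "x \<notin> Q\<^sub>0 \<Longrightarrow> w x = 0"
begin

definition \<nu> :: "'a measure" where
  "\<nu> = density lebesgue (\<lambda>x. ennreal (w x))"

definition mean :: "'a set \<Rightarrow> real" where
  "mean A = measure \<nu> A / measure lebesgue A"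

text \<open>With the family as a parameter, the same function serves globally, as
  \<open>mx D\<close>, and localised to the cubes inside a fixed one. Where no member contains
  \<open>x\<close>, the empty supremum gives 0.\<close>

definition mx :: "'a set set \<Rightarrow> 'a \<Rightarrow> ennreal" where
  "mx \<G> x = (SUP A\<in>{A \<in> \<G>. x \<in> A}. ennreal (mean A))"

lemma weight_measurable [measurable]: "w \<in> borel_measurable lebesgue"
  using weight_integrable by simp

lemma sets_\<nu> [simp]: "sets \<nu> = sets lebesgue"
  by (simp add: \<nu>_def)

lemma ac_\<nu>: "absolutely_continuous lebesgue \<nu>"
  unfolding \<nu>_def by (rule absolutely_continuousI_density) simp

lemma emeasure_\<nu>:
  "A \<in> sets lebesgue \<Longrightarrow> emeasure \<nu> A = (\<integral>\<^sup>+x. ennreal (w x) * indicator A x \<partial>lebesgue)"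
  unfolding \<nu>_def by (rule emeasure_density) simp_all

lemma finite_\<nu>: "finite_measure \<nu>"
proof
  have "emeasure \<nu> (space \<nu>) = (\<integral>\<^sup>+x. ennreal (w x) \<partial>lebesgue)"
    by (simp add: \<nu>_def emeasure_density)
  also have "\<dots> = ennreal (integral\<^sup>L lebesgue w)"
    by (rule nn_integral_eq_integral[OF weight_integrable]) (simp add: weight_nonneg)
  finally show "emeasure \<nu> (space \<nu>) \<noteq> \<infinity>" by simp
qed

lemma emeasure_eq_measure_\<nu>: "emeasure \<nu> A = ennreal (measure \<nu> A)"
  by (rule finite_measure.emeasure_eq_measure[OF finite_\<nu>])

lemma measure_\<nu>_mono: "A \<subseteq> B \<Longrightarrow> B \<in> sets lebesgue \<Longrightarrow> measure \<nu> A \<le> measure \<nu> B"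
  by (rule finite_measure.finite_measure_mono[OF finite_\<nu>]) simp_all

lemma less_mean_iff: "A \<in> D \<Longrightarrow> c < mean A \<longleftrightarrow> c * measure lebesgue A < measure \<nu> A"
  unfolding mean_def by (simp add: measure_pos pos_less_divide_eq)

lemma mean_nonneg: "0 \<le> mean A"
  by (simp add: mean_def)

lemma superlevel_mx:
  "{x. c < mx \<G> x} = \<Union>{A \<in> \<G>. c < ennreal (mean A)}"
  unfolding mx_def by (auto simp: less_SUP_iff)

lemma mx_measurable [measurable]:
  assumes "\<G> \<subseteq> D"
  shows "mx \<G> \<in> borel_measurable lebesgue"
proof (rule borel_measurableI_greater)
  fix c
  have "{x. c < mx \<G> x} \<in> sets lebesgue"
    unfolding superlevel_mx using assms by (intro sets_Union) auto
  then show "{x \<in> space lebesgue. c < mx \<G> x} \<in> sets lebesgue" by simp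
qed

text \<open>Each maximal cube with mean above \<open>c\<close> satisfies c \<bar>A\<bar> \<le>
  \<nu>(A). Summing over these cubes, all inside \<open>Q\<close>, leaves at most the \<nu>-measure
  of \<open>Q\<close>.\<close>

lemma mx_weak_type:
  assumes "\<G> \<subseteq> D" "\<Union>\<G> \<subseteq> Q" "Q \<in> D" "0 \<le> c"
  shows "ennreal c * emeasure lebesgue {x. ennreal c < mx \<G> x} \<le> ennreal (measure \<nu> Q)"
proof -
  let ?H = "{A \<in> \<G>. ennreal c < ennreal (mean A)}"
  \<comment> \<open>The factor \<open>c\<close> is absorbed into the measure to match the form of
    \<open>emeasure_Union_le\<close>; dividing by it would fail for \<open>c = 0\<close>.\<close>
  let ?\<alpha> = "scale_measure (ennreal c) lebesgue :: 'a measure"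
  have H: "?H \<subseteq> D" using assms by auto
  have ac: "absolutely_continuous lebesgue ?\<alpha>"
    unfolding absolutely_continuous_def by (auto simp: null_sets_def)
  have "emeasure ?\<alpha> (\<Union>?H) \<le> 1 * emeasure \<nu> (\<Union>?H)"
  proof (rule emeasure_Union_le[OF H _ ac sets_\<nu> ac_\<nu>])
    fix A assume "A \<in> maximals ?H"
    then have A: "A \<in> D" "c < mean A"
      using H assms(4) by (auto simp: maximals_def ennreal_less_iff)
    then have "c * measure lebesgue A \<le> measure \<nu> A"
      using less_mean_iff by (simp add: less_imp_le)
    then show "emeasure ?\<alpha> A \<le> 1 * emeasure \<nu> A"
      by (simp add: emeasure_D[OF A(1)] emeasure_eq_measure_\<nu> ennreal_mult'[symmetric] assms(4)
          ennreal_leI)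
  qed simp
  also have "\<dots> \<le> emeasure \<nu> Q"
    using emeasure_mono[of "\<Union>?H" Q \<nu>] assms sets_D by auto
  finally show ?thesis by (simp add: superlevel_mx emeasure_eq_measure_\<nu>)
qed

text \<open>A maximal cube \<open>A\<close> with mean above \<open>c\<close> is not
  \<open>Q\<^sub>0\<close>, and by maximality its parent \<open>B\<close> has mean at most
  \<open>c\<close>. Doubling then gives \<nu>(A) \<le> \<nu>(B) \<le> c \<bar>B\<bar> \<le> C c
  \<bar>A\<bar>, which is summed over such cubes.\<close>

lemma mx_reverse_weak_type:
  assumes "mean Q\<^sub>0 \<le> c"
  shows "emeasure \<nu> {x. ennreal c < mx D x} \<le> ennreal (C * c) * emeasure lebesgue {x. ennreal c < mx D x}"
  unfolding superlevel_mx
proof (rule emeasure_Union_le[OF _ sets_\<nu> ac_\<nu> refl])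
  let ?H = "{A \<in> D. ennreal c < ennreal (mean A)}"
  have c: "0 \<le> c" using mean_nonneg assms by (rule order_trans)
  show "?H \<subseteq> D" by auto
  show "absolutely_continuous lebesgue (lebesgue :: 'a measure)"
    by (simp add: absolutely_continuous_def)
  fix A assume max: "A \<in> maximals ?H"
  then have A: "A \<in> D" "c < mean A"
    using c by (auto simp: maximals_def ennreal_less_iff)
  then have "A \<noteq> Q\<^sub>0" using assms by auto
  from parent[OF A(1) this] obtain B
    where B: "B \<in> D" "A \<subset> B" "measure lebesgue B \<le> C * measure lebesgue A" by blast
  have "\<not> c < mean B"
    using max B c unfolding maximals_def by (auto simp: ennreal_less_iff)
  then have "measure \<nu> B \<le> c * measure lebesgue B"
    using less_mean_iff[OF B(1)] by simp
  moreover have "measure \<nu> A \<le> measure \<nu> B"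
    using measure_\<nu>_mono B sets_D by auto
  moreover have "c * measure lebesgue B \<le> c * (C * measure lebesgue A)"
    using B(3) c by (rule mult_left_mono)
  ultimately have "measure \<nu> A \<le> C * c * measure lebesgue A"
    by (simp add: mult_ac)
  then show "emeasure \<nu> A \<le> ennreal (C * c) * emeasure lebesgue A"
    using c doubling_nonneg
    by (simp add: emeasure_D[OF A(1)] emeasure_eq_measure_\<nu> ennreal_mult'[symmetric] ennreal_leI)
qed

text \<open>The weak type estimate bounds n times the measure of the infinity set by
  \<nu>(\<open>Q\<^sub>0\<close>) for every n. Unless that measure is 0, letting n grow contradicts
  the finiteness of \<nu>.\<close>

lemma mx_finite_AE: "AE x in lebesgue. mx D x < \<infinity>"
proof (rule AE_I)
  let ?N = "{x. mx D x = \<infinity>}"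
  have N: "?N = {x \<in> space lebesgue. mx D x = \<infinity>}" by simp
  show "?N \<in> sets lebesgue"
    unfolding N using mx_measurable[OF subset_refl] by measurable
  show "{x \<in> space lebesgue. \<not> mx D x < \<infinity>} \<subseteq> ?N"
    by (auto simp: less_top[symmetric])
  show "emeasure lebesgue ?N = 0"
  proof (rule ccontr)
    assume "emeasure lebesgue ?N \<noteq> 0"
    then have top: "\<infinity> * emeasure lebesgue ?N = \<infinity>" by (simp add: ennreal_top_mult)
    have "(\<lambda>n. ennreal (real n) * emeasure lebesgue ?N) \<longlonglongrightarrow> \<infinity> * emeasure lebesgue ?N"
    proof (rule tendsto_mult_ennreal)
      show "(\<lambda>n. ennreal (real n)) \<longlonglongrightarrow> \<infinity>"
        using of_nat_tendsto_top_ennreal by (simp add: ennreal_of_nat_eq_real_of_nat)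
    qed (use \<open>emeasure lebesgue ?N \<noteq> 0\<close> in auto)
    moreover have "ennreal (real n) * emeasure lebesgue ?N \<le> ennreal (measure \<nu> Q\<^sub>0)" for n
    proof -
      have "{x. ennreal (real n) < mx D x} \<in> sets lebesgue"
        unfolding superlevel_mx by (intro sets_Union) auto
      then have "emeasure lebesgue ?N \<le> emeasure lebesgue {x. ennreal (real n) < mx D x}"
        by (intro emeasure_mono) auto
      then have "ennreal (real n) * emeasure lebesgue ?N
          \<le> ennreal (real n) * emeasure lebesgue {x. ennreal (real n) < mx D x}"
        by (rule mult_left_mono) simp
      also have "\<dots> \<le> ennreal (measure \<nu> Q\<^sub>0)"
        using subset_top by (intro mx_weak_type) (auto simp: top_in_D)
      finally show ?thesis .
    qed
    ultimately have "\<infinity> * emeasure lebesgue ?N \<le> ennreal (measure \<nu> Q\<^sub>0)"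
      by (intro LIMSEQ_le_const2) auto
    with top show False by (simp add: top_unique)
  qed
qed

text \<open>A substitute for the Lebesgue differentiation theorem: a set on which \<open>M \<le> r < s < w\<close> is covered,
  inside an open set of almost the same measure, by dyadic cubes of mean at most \<open>r\<close>.\<close>

lemma weight_le_mx_AE: "AE x in lebesgue. ennreal (w x) \<le> mx D x"
proof -
  define E where "E r s = {x. mx D x \<le> ennreal r \<and> s < w x}" for r s
  have E_null: "E r s \<in> null_sets lebesgue" if "0 \<le> r" "r < s" for r s
  proof -
    have sets: "E r s \<in> sets lebesgue"
    proof -
      have "{x \<in> space lebesgue. mx D x \<le> ennreal r \<and> s < w x} \<in> sets lebesgue"
        using mx_measurable[OF subset_refl] by measurable
      then show ?thesis by (simp add: E_def)
    qed
    have E_sub: "E r s \<subseteq> Q\<^sub>0"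
      using weight_outside that unfolding E_def by force
    have E_lm: "E r s \<in> lmeasurable"
      using E_sub sets lmeasurable_D[OF top_in_D] fmeasurableI2 by blast
    have lower: "s * measure lebesgue (E r s) \<le> measure \<nu> (E r s)"
    proof -
      have "ennreal (s * measure lebesgue (E r s)) = (\<integral>\<^sup>+x. ennreal s * indicator (E r s) x \<partial>lebesgue)"
        using sets that E_lm
        by (simp add: nn_integral_cmult ennreal_mult' emeasure_eq_measure2)
      also have "\<dots> \<le> emeasure \<nu> (E r s)"
        unfolding emeasure_\<nu>[OF sets]
        by (intro nn_integral_mono) (auto simp: E_def indicator_def intro: ennreal_leI)
      finally show ?thesis
        by (simp add: emeasure_eq_measure_\<nu>)
    qed
    have upper: "measure \<nu> (E r s) \<le> r * (measure lebesgue (E r s) + \<delta>)" if \<delta>: "0 < \<delta>" for \<delta>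
    proof -
      obtain U where U: "open U" "E r s \<subseteq> U" "U - E r s \<in> lmeasurable"
        "emeasure lebesgue (U - E r s) < ennreal \<delta>"
        using sets_lebesgue_outer_open[OF sets \<delta>] by metis
      have Ueq: "U = E r s \<union> (U - E r s)" using U(2) by auto
      have Ulm: "U \<in> lmeasurable"
        by (subst Ueq) (rule fmeasurable.Un[OF E_lm U(3)])
      have "measure lebesgue U = measure lebesgue (E r s) + measure lebesgue (U - E r s)"
        using measurable_measure_Diff[OF Ulm sets U(2)] by simp
      moreover have "measure lebesgue (U - E r s) < \<delta>"
        using U(3,4) \<delta> by (simp add: emeasure_eq_measure2 ennreal_less_iff)
      ultimately have Um: "measure lebesgue U \<le> measure lebesgue (E r s) + \<delta>" by simp
      let ?G = "{B \<in> D. B \<subseteq> U \<and> B \<inter> E r s \<noteq> {}}"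
      have G: "?G \<subseteq> D" by auto
      have cover: "E r s \<subseteq> \<Union>?G"
        using fine[OF U(1)] U(2) E_sub by blast
      have "emeasure \<nu> (\<Union>?G) \<le> ennreal r * emeasure lebesgue (\<Union>?G)"
      proof (rule emeasure_Union_le[OF G sets_\<nu> ac_\<nu> refl])
        show "absolutely_continuous lebesgue (lebesgue :: 'a measure)"
          by (simp add: absolutely_continuous_def)
        fix B assume "B \<in> maximals ?G"
        then obtain x where B: "B \<in> D" "x \<in> B" "x \<in> E r s" by (auto simp: maximals_def)
        have "ennreal (mean B) \<le> mx D x"
          unfolding mx_def using B by (intro SUP_upper) auto
        also have "\<dots> \<le> ennreal r" using B by (simp add: E_def)
        finally have "\<not> r < mean B" using \<open>0 \<le> r\<close> by simp
        then have "measure \<nu> B \<le> r * measure lebesgue B"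
          using less_mean_iff[OF B(1)] by simp
        then show "emeasure \<nu> B \<le> ennreal r * emeasure lebesgue B"
          using \<open>0 \<le> r\<close>
          by (simp add: emeasure_D[OF B(1)] emeasure_eq_measure_\<nu> ennreal_mult'[symmetric] ennreal_leI)
      qed
      also have "\<dots> \<le> ennreal r * emeasure lebesgue U"
        using Ulm by (intro mult_left_mono emeasure_mono) auto
      also have "\<dots> = ennreal (r * measure lebesgue U)"
        using Ulm \<open>0 \<le> r\<close> by (simp add: emeasure_eq_measure2 ennreal_mult')
      finally have "emeasure \<nu> (\<Union>?G) \<le> ennreal (r * measure lebesgue U)" .
      moreover have "emeasure \<nu> (E r s) \<le> emeasure \<nu> (\<Union>?G)"
        using cover sets_Union[OF G] by (intro emeasure_mono) auto
      ultimately have "emeasure \<nu> (E r s) \<le> ennreal (r * measure lebesgue U)"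
        by (rule order_trans[rotated])
      then have "measure \<nu> (E r s) \<le> r * measure lebesgue U"
        using \<open>0 \<le> r\<close> by (simp add: emeasure_eq_measure_\<nu>)
      also have "\<dots> \<le> r * (measure lebesgue (E r s) + \<delta>)"
        using Um \<open>0 \<le> r\<close> by (rule mult_left_mono)
      finally show ?thesis .
    qed
    have "(s - r) * measure lebesgue (E r s) \<le> 0"
    proof (rule field_le_epsilon)
      fix e :: real assume "0 < e"
      \<comment> \<open>The excess \<delta> is taken as \<open>e / (r + 1)\<close> because
        \<open>r\<close> may be 0; it still satisfies r \<delta> \<le> e.\<close>
      then have "s * measure lebesgue (E r s) \<le> r * (measure lebesgue (E r s) + e / (r + 1))"
        using order_trans[OF lower upper[of "e / (r + 1)"]] \<open>0 \<le> r\<close> by simp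
      also have "\<dots> \<le> r * measure lebesgue (E r s) + e"
        using \<open>0 < e\<close> \<open>0 \<le> r\<close> by (simp add: field_simps)
      finally show "(s - r) * measure lebesgue (E r s) \<le> 0 + e"
        by (simp add: algebra_simps)
    qed
    then have "measure lebesgue (E r s) = 0"
      using that by (simp add: mult_le_0_iff order_antisym)
    then show ?thesis
      using E_lm by (simp add: null_sets_def emeasure_eq_measure2 fmeasurableD)
  qed
  \<comment> \<open>Rational \<open>r\<close> and \<open>s\<close> keep the exceptional null sets
    countable in number, and they suffice to separate the maximal function from the weight.\<close>
  let ?N = "\<Union>(r, s)\<in>{(r, s). r \<in> \<rat> \<and> s \<in> \<rat> \<and> 0 \<le> r \<and> r < s}. E r s"
  have "countable {(r, s). r \<in> \<rat> \<and> s \<in> \<rat> \<and> 0 \<le> r \<and> (r::real) < s}"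
    by (rule countable_subset[of _ "\<rat> \<times> \<rat>"]) (auto intro: countable_rat)
  then have "?N \<in> null_sets lebesgue"
    using E_null by (intro null_sets_UN') auto
  then have "AE x in lebesgue. x \<notin> ?N" by (rule AE_not_in)
  then show ?thesis
  proof eventually_elim
    case (elim x)
    show ?case
    proof (rule ccontr)
      assume "\<not> ennreal (w x) \<le> mx D x"
      then have less: "mx D x < ennreal (w x)" by simp
      then obtain m where m: "mx D x = ennreal m" "0 \<le> m"
        by (cases "mx D x") auto
      with less have "m < w x" by (simp add: ennreal_less_iff)
      obtain r where r: "r \<in> \<rat>" "m < r" "r < w x" using Rats_dense_in_real[OF \<open>m < w x\<close>] by blast
      obtain s where s: "s \<in> \<rat>" "r < s" "s < w x" using Rats_dense_in_real[OF r(3)] by blast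
      have "x \<in> E r s"
        using m r s by (auto simp: E_def intro: ennreal_leI)
      then show False using elim r s m by auto
    qed
  qed
qed

end

section \<open>Pointwise estimates by sums over dyadic levels\<close>

lemma dyadic_scale:
  fixes t m :: real
  assumes "0 < t" "t < m"
  obtains k :: nat where "2 ^ k * t < m" "m \<le> 2 ^ Suc k * t"
proof -
  obtain n where n: "m / t < 2 ^ n"
    using real_arch_pow[of 2 "m / t"] by auto
  then have "\<exists>n. m \<le> 2 ^ n * t"
    using assms by (intro exI[of _ n]) (simp add: field_simps)
  from exists_least_iff[THEN iffD1, OF this] obtain k
    where k: "m \<le> 2 ^ k * t" "\<And>j. j < k \<Longrightarrow> \<not> m \<le> 2 ^ j * t" by blast
  \<comment> \<open>The least exponent \<open>k\<close> with the upper bound is positive because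
    \<open>t < m\<close>; its predecessor then provides the strict lower bound.\<close>
  with assms have "k \<noteq> 0" by (intro notI) auto
  then obtain j where "k = Suc j" using not0_implies_Suc by blast
  with k show ?thesis by (intro that[of j]) force+
qed

lemma le_suminf_ennreal:
  fixes f :: "nat \<Rightarrow> ennreal"
  shows "f k \<le> suminf f"
  using sum_le_suminf[of f "{k}"] by simp

text \<open>The second bound carries the induction for the first: if 2^n a is still below
  \<open>M\<close>, the earlier terms add up to at most 2^n a, so the new total is at most twice 2^n
  a.\<close>

lemma sum_dyadic_levels:
  fixes M :: real
  assumes "0 \<le> M" "0 < a"
  shows "(\<Sum>k<n. if 2 ^ k * a < M then 2 ^ k * a else 0) \<le> 2 * M \<and>
         (\<Sum>k<n. if 2 ^ k * a < M then 2 ^ k * a else 0) \<le> 2 ^ n * a"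
  using assms by (induction n) (auto simp: mult.commute)

text \<open>The levels below \<open>M\<close> form a geometric progression, dominated by twice its
  last term. Integrated, this recovers the integral of the maximal function from its superlevel
  sets.\<close>

lemma suminf_dyadic_levels:
  assumes "0 < a"
  shows "(\<Sum>k. ennreal (2 ^ k * a) * indicator {y. ennreal (2 ^ k * a) < y} M) \<le> 2 * M"
proof (cases M)
  case (real m)
  have "(\<Sum>k<n. ennreal (2 ^ k * a) * indicator {y. ennreal (2 ^ k * a) < y} M) \<le> 2 * M" for n
  proof -
    have "(\<Sum>k<n. ennreal (2 ^ k * a) * indicator {y. ennreal (2 ^ k * a) < y} M)
        = (\<Sum>k<n. ennreal (if 2 ^ k * a < m then 2 ^ k * a else 0))"
      using assms real by (intro sum.cong) (auto simp: ennreal_less_iff)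
    also have "\<dots> = ennreal (\<Sum>k<n. if 2 ^ k * a < m then 2 ^ k * a else 0)"
      using assms by (intro sum_ennreal) auto
    also have "\<dots> \<le> ennreal (2 * m)"
      using sum_dyadic_levels[of m a n] assms real by (intro ennreal_leI) auto
    finally show ?thesis using real by (simp add: ennreal_mult')
  qed
  then show ?thesis by (intro suminf_le_const) auto
qed (simp add: ennreal_mult_top)

text \<open>The 1 accounts for values up to the base level; the quotient is 2^q times the geometric
  series with ratio \<open>2 powr (q - 1)\<close>, which converges for \<open>q < 1\<close>.\<close>

definition kolmogorov_const :: "real \<Rightarrow> real" where
  "kolmogorov_const q = 1 + 2 powr q / (1 - 2 powr (q - 1))"

lemma kolmogorov_const_nonneg: "q < 1 \<Longrightarrow> 0 \<le> kolmogorov_const q"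
proof -
  assume "q < 1"
  then have "2 powr (q - 1) < (2::real) powr 0" by (intro powr_less_mono) auto
  then show ?thesis by (simp add: kolmogorov_const_def)
qed

text \<open>Either the first term suffices, or \<open>enn2real M\<close> lies between 2^k t and
  2^(k+1) t for some k and the k-th summand alone dominates. An infinite \<open>M\<close> falls
  under the first case, as \<open>enn2real\<close> sends it to 0.\<close>

lemma powr_le_dyadic_levels:
  assumes "0 < t" "0 < q"
  shows "ennreal (enn2real M powr q) \<le> ennreal (t powr q) +
     (\<Sum>k. ennreal ((2 ^ Suc k * t) powr q) * indicator {y. ennreal (2 ^ k * t) < y} M)"
proof (cases "enn2real M \<le> t")
  case True
  then have "ennreal (enn2real M powr q) \<le> ennreal (t powr q)"
    using assms by (intro ennreal_leI powr_mono2) auto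
  then show ?thesis by (rule order_trans) simp
next
  case False
  let ?f = "\<lambda>k. ennreal ((2 ^ Suc k * t) powr q) * indicator {y. ennreal (2 ^ k * t) < y} M"
  from False obtain k where k: "2 ^ k * t < enn2real M" "enn2real M \<le> 2 ^ Suc k * t"
    using dyadic_scale[OF assms(1)] by (metis not_le)
  have "ennreal (2 ^ k * t) < M"
    using k(1) assms by (cases M) (auto simp: ennreal_less_iff)
  then have "ennreal (enn2real M powr q) \<le> ?f k"
    using k(2) assms by (auto intro!: ennreal_leI powr_mono2)
  also have "\<dots> \<le> suminf ?f"
    by (rule le_suminf_ennreal)
  also have "\<dots> \<le> ennreal (t powr q) + suminf ?f" by simp
  finally show ?thesis .
qed

text \<open>Here \<open>a\<close> will be the localised maximal function and \<open>b\<close> the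
  contribution of the ancestors, which makes \<open>b powr q\<close> a good constant to
  subtract.\<close>

lemma abs_powr_max_diff_le:
  fixes a b :: real
  assumes "0 \<le> a" "0 \<le> b" "0 < q"
  shows "\<bar>max a b powr q - b powr q\<bar> \<le> a powr q"
proof (cases "a \<le> b")
  case False
  then have "b powr q \<le> a powr q" using assms by (intro powr_mono2) auto
  then show ?thesis using False by simp
qed simp

text \<open>Above \<open>a\<close>, the logarithm of \<open>u\<close> is at most \<open>ln a\<close>
  plus \<open>ln 2\<close> for each level 2^j a lying below \<open>u\<close>.\<close>

lemma log_le_dyadic_levels:
  fixes u a :: real
  assumes "0 \<le> u" "1 \<le> a"
  shows "ennreal (u * max (ln u) 0) \<le> ennreal (ln a) * ennreal u +
    (\<Sum>k. ennreal (ln 2) * (ennreal u * indicator {v. 2 ^ k * a < v} u))"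
proof (cases "u \<le> a")
  case True
  have "max (ln u) 0 \<le> ln a"
    using True assms by (cases "u = 0") auto
  then have "ennreal (u * max (ln u) 0) \<le> ennreal (ln a) * ennreal u"
    using assms by (auto simp: ennreal_mult[symmetric] mult.commute intro!: ennreal_leI mult_left_mono)
  then show ?thesis by (rule order_trans) simp
next
  case False
  let ?f = "\<lambda>k. ennreal (ln 2) * (ennreal u * indicator {v. 2 ^ k * a < v} u)"
  have a: "0 < a" using assms by simp
  from False obtain k where k: "2 ^ k * a < u" "u \<le> 2 ^ Suc k * a"
    using dyadic_scale[OF a] by (metis not_le)
  have "ln u \<le> ln (2 ^ Suc k * a)"
    using False a k by (intro ln_mono) auto
  also have "\<dots> = real (Suc k) * ln 2 + ln a"
    using a by (simp add: ln_mult ln_realpow del: power_Suc)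
  finally have "max (ln u) 0 \<le> ln a + real (Suc k) * ln 2"
    using assms False by simp
  then have "u * max (ln u) 0 \<le> u * (ln a + real (Suc k) * ln 2)"
    using assms by (intro mult_left_mono)
  also have "\<dots> = ln a * u + real (Suc k) * (ln 2 * u)" by (simp add: algebra_simps)
  finally have "ennreal (u * max (ln u) 0) \<le> ennreal (ln a * u + real (Suc k) * (ln 2 * u))"
    by (rule ennreal_leI)
  \<comment> \<open>The factor k + 1 becomes a sum over the levels j = 0, ..., k, each of which is
    below \<open>u\<close>.\<close>
  also have "\<dots> = ennreal (ln a) * ennreal u + (\<Sum>j<Suc k. ennreal (ln 2 * u))"
    using assms by (subst sum_ennreal) (auto simp: ennreal_mult[symmetric] simp del: sum.lessThan_Suc)
  also have "(\<Sum>j<Suc k. ennreal (ln 2 * u)) = (\<Sum>j<Suc k. ?f j)"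
  proof (rule sum.cong[OF refl])
    fix j assume "j \<in> {..<Suc k}"
    then have "(2::real) ^ j \<le> 2 ^ k" by (intro power_increasing) auto
    then have "2 ^ j * a < u"
      using k(1) a mult_right_mono[of "2 ^ j" "2 ^ k" a] by linarith
    then show "ennreal (ln 2 * u) = ?f j" using assms by (simp add: ennreal_mult)
  qed
  also have "(\<Sum>j<Suc k. ?f j) \<le> suminf ?f"
    by (rule sum_le_suminf) auto
  finally show ?thesis by (simp add: add_left_mono)
qed

section \<open>Kolmogorov's inequality, localisation and Stein's theorem\<close>

context dyadic_weight
begin

lemma set_superlevel [measurable]: "\<G> \<subseteq> D \<Longrightarrow> {x. c < mx \<G> x} \<in> sets lebesgue"
  unfolding superlevel_mx by (intro sets_Union) auto

text \<open>Kolmogorov's inequality. Since \<nu>(Q) \<le> t \<bar>Q\<bar>, the weak type estimate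
  bounds the superlevel set at 2^k t by \<bar>Q\<bar> / 2^k; its contribution to the q-th power
  decays like 2^((q-1)k), so the sum converges for \<open>q < 1\<close>.\<close>

lemma mx_powr_integral:
  assumes \<G>: "\<G> \<subseteq> D" "\<Union>\<G> \<subseteq> Q" and Q: "Q \<in> D"
    and t: "0 < t" "mean Q \<le> t" and q: "0 < q" "q < 1"
  shows "(\<integral>\<^sup>+x. ennreal (enn2real (mx \<G> x) powr q) * indicator Q x \<partial>lebesgue)
         \<le> ennreal (kolmogorov_const q * t powr q * measure lebesgue Q)"
proof -
  let ?m = "measure lebesgue Q"
  let ?E = "\<lambda>k. {x. ennreal (2 ^ k * t) < mx \<G> x}"
  let ?r = "2 powr (q - 1) :: real"
  have r: "0 < ?r" "?r < 1"
    using powr_less_mono[of "q - 1" 0 "2::real"] q by auto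
  have [measurable]: "Q \<in> sets lebesgue" using Q by (rule sets_D)
  have [measurable]: "?E k \<in> sets lebesgue" for k using \<G>(1) by (rule set_superlevel)
  have E_sub: "?E k \<subseteq> Q" for k
    using \<G>(2) unfolding superlevel_mx by auto
  have E_lm: "?E k \<in> lmeasurable" for k
    by (rule fmeasurableI2[OF lmeasurable_D[OF Q] E_sub]) measurable
  have E_le: "measure lebesgue (?E k) \<le> ?m / 2 ^ k" for k
  proof -
    have "ennreal (2 ^ k * t) * emeasure lebesgue (?E k) \<le> ennreal (measure \<nu> Q)"
      using mx_weak_type[OF \<G> Q, of "2 ^ k * t"] t by simp
    then have "2 ^ k * t * measure lebesgue (?E k) \<le> measure \<nu> Q"
      using t by (simp add: emeasure_eq_measure2[OF E_lm] ennreal_mult[symmetric])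
    also have "\<dots> \<le> t * ?m"
      using t(2) measure_pos[OF Q] by (simp add: mean_def pos_divide_le_eq)
    finally show ?thesis using t(1) by (simp add: field_simps)
  qed
  have level: "ennreal ((2 ^ Suc k * t) powr q) * emeasure lebesgue (?E k)
      \<le> ennreal (2 powr q * t powr q * ?m * ?r ^ k)" for k
  proof -
    have "(2 ^ Suc k * t) powr q * measure lebesgue (?E k) \<le> (2 ^ Suc k * t) powr q * (?m / 2 ^ k)"
      by (rule mult_left_mono[OF E_le]) simp
    also have "\<dots> = 2 powr q * t powr q * ?m * ?r ^ k"
    proof -
      have "(2 ^ Suc k * t) powr q = (2 powr (real (Suc k))) powr q * t powr q"
        using t by (simp add: powr_mult powr_realpow del: of_nat_Suc power_Suc)
      also have "(2 powr (real (Suc k))) powr q = 2 powr q * (2 powr q) ^ k"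
        by (simp add: powr_powr powr_add[symmetric] powr_power algebra_simps)
      finally have "(2 ^ Suc k * t) powr q = 2 powr q * (2 powr q) ^ k * t powr q" .
      moreover have "?r ^ k = (2 powr q) ^ k / 2 ^ k"
        by (simp add: powr_diff power_divide)
      ultimately show ?thesis by simp
    qed
    finally show ?thesis
      by (simp add: emeasure_eq_measure2[OF E_lm] ennreal_mult[symmetric] ennreal_leI)
  qed
  have "(\<integral>\<^sup>+x. ennreal (enn2real (mx \<G> x) powr q) * indicator Q x \<partial>lebesgue)
     \<le> (\<integral>\<^sup>+x. ennreal (t powr q) * indicator Q x +
          (\<Sum>k. ennreal ((2 ^ Suc k * t) powr q) * indicator (?E k) x) \<partial>lebesgue)"
  proof (rule nn_integral_mono)
    fix x
    show "ennreal (enn2real (mx \<G> x) powr q) * indicator Q x \<le> ennreal (t powr q) * indicator Q x +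
          (\<Sum>k. ennreal ((2 ^ Suc k * t) powr q) * indicator (?E k) x)"
      using powr_le_dyadic_levels[OF t(1) q(1), of "mx \<G> x"]
      by (cases "x \<in> Q") (simp_all add: indicator_def)
  qed
  also have "\<dots> = (\<integral>\<^sup>+x. ennreal (t powr q) * indicator Q x \<partial>lebesgue) +
          (\<integral>\<^sup>+x. (\<Sum>k. ennreal ((2 ^ Suc k * t) powr q) * indicator (?E k) x) \<partial>lebesgue)"
    by (rule nn_integral_add) measurable
  also have "(\<integral>\<^sup>+x. ennreal (t powr q) * indicator Q x \<partial>lebesgue) = ennreal (t powr q * ?m)"
    by (simp add: nn_integral_cmult emeasure_D[OF Q] ennreal_mult)
  also have "(\<integral>\<^sup>+x. (\<Sum>k. ennreal ((2 ^ Suc k * t) powr q) * indicator (?E k) x) \<partial>lebesgue)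
      = (\<Sum>k. ennreal ((2 ^ Suc k * t) powr q) * emeasure lebesgue (?E k))"
    by (subst nn_integral_suminf) (simp_all add: nn_integral_cmult del: power_Suc)
  also have "\<dots> \<le> (\<Sum>k. ennreal (2 powr q * t powr q * ?m * ?r ^ k))"
    by (intro suminf_le level) auto
  also have "\<dots> = ennreal (2 powr q * t powr q * ?m * (1 / (1 - ?r)))"
    using r by (intro suminf_ennreal_eq sums_mult geometric_sums) auto
  also have "ennreal (t powr q * ?m) + ennreal (2 powr q * t powr q * ?m * (1 / (1 - ?r)))
     = ennreal (kolmogorov_const q * t powr q * ?m)"
    using r by (subst ennreal_plus[symmetric]) (auto simp: kolmogorov_const_def algebra_simps)
  finally show ?thesis by (simp add: add_left_mono)
qed

text \<open>Only the dyadic cubes inside \<open>Q\<close> make the maximal function vary on \<open>Q\<close>: the ancestors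
  of \<open>Q\<close> contribute a constant.\<close>

lemma mx_localise:
  assumes Q: "Q \<in> D"
  obtains b where "0 \<le> b"
    and "\<And>x. x \<in> Q \<Longrightarrow> x \<notin> skeleton \<Longrightarrow> mx D x = max (mx {A \<in> D. A \<subseteq> Q} x) (ennreal b)"
proof
  let ?S = "{A \<in> D. Q \<subseteq> A}"
  \<comment> \<open>There are finitely many ancestors, \<open>Q\<close> included, so their supremum
    is a maximum and hence a finite real.\<close>
  let ?b = "Max (mean ` ?S)"
  have fin: "finite (mean ` ?S)" and ne: "mean ` ?S \<noteq> {}"
    using finite_ancestors[OF Q] Q by auto
  show b: "0 \<le> ?b"
    using Max_in[OF fin ne] mean_nonneg by auto
  fix x assume x: "x \<in> Q" "x \<notin> skeleton"
  \<comment> \<open>Off the skeleton \<open>x\<close> is interior to every cube containing it, so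
    none of these can have interior disjoint from that of \<open>Q\<close>; each is nested with
    \<open>Q\<close>.\<close>
  have "{A \<in> D. x \<in> A} = {A \<in> {A \<in> D. A \<subseteq> Q}. x \<in> A} \<union> ?S"
  proof -
    have "A \<subseteq> Q \<or> Q \<subseteq> A" if A: "A \<in> D" "x \<in> A" for A
      using nested[OF A(1) Q] mem_interior[OF A x(2)] mem_interior[OF Q x] by blast
    with x show ?thesis by blast
  qed
  then have "mx D x = sup (mx {A \<in> D. A \<subseteq> Q} x) (SUP A\<in>?S. ennreal (mean A))"
    unfolding mx_def by (simp add: SUP_union)
  moreover have "(SUP A\<in>?S. ennreal (mean A)) = ennreal ?b"
  proof (rule antisym)
    show "(SUP A\<in>?S. ennreal (mean A)) \<le> ennreal ?b"
      by (intro SUP_least ennreal_leI Max_ge fin imageI)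
    from Max_in[OF fin ne] obtain A where "A \<in> ?S" "?b = mean A" by blast
    then show "ennreal ?b \<le> (SUP A\<in>?S. ennreal (mean A))"
      by (metis (no_types, lifting) SUP_upper)
  qed
  ultimately show "mx D x = max (mx {A \<in> D. A \<subseteq> Q} x) (ennreal ?b)"
    by (simp add: sup_max)
qed

text \<open>The constant is \<open>b powr q\<close> with \<open>b\<close> from
  \<open>mx_localise\<close>. The remaining deviation is at most the q-th power of the localised
  maximal function, to which Kolmogorov's inequality applies.\<close>

lemma mx_powr_oscillation:
  assumes Q: "Q \<in> D" and t: "0 < t" "mean Q \<le> t" and q: "0 < q" "q < 1"
  obtains c where "(\<integral>\<^sup>+x. ennreal \<bar>enn2real (mx D x) powr q - c\<bar> * indicator Q x \<partial>lebesgue)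
         \<le> ennreal (kolmogorov_const q * t powr q * measure lebesgue Q)"
proof -
  let ?G = "{A \<in> D. A \<subseteq> Q}"
  from mx_localise[OF Q] obtain b where b: "0 \<le> b"
    "\<And>x. x \<in> Q \<Longrightarrow> x \<notin> skeleton \<Longrightarrow> mx D x = max (mx ?G x) (ennreal b)" by blast
  have "AE x in lebesgue. x \<notin> skeleton" by (rule AE_not_in[OF skeleton_null])
  then have "AE x in lebesgue. ennreal \<bar>enn2real (mx D x) powr q - b powr q\<bar> * indicator Q x
      \<le> ennreal (enn2real (mx ?G x) powr q) * indicator Q x"
    using mx_finite_AE
  proof eventually_elim
    case (elim x)
    show ?case
    proof (cases "x \<in> Q")
      case True
      with elim b have eq: "mx D x = max (mx ?G x) (ennreal b)" by blast
      \<comment> \<open>\<open>enn2real\<close> sends \<infinity> to 0, so it commutes with the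
        maximum only once finiteness is known.\<close>
      with elim have "mx ?G x < \<infinity>" by simp
      then have "enn2real (mx D x) = max (enn2real (mx ?G x)) b"
        using eq b(1) by (cases "mx ?G x") (auto simp: max_def)
      then show ?thesis
        using abs_powr_max_diff_le[of "enn2real (mx ?G x)" b q] b(1) q True
        by (simp add: ennreal_leI)
    qed simp
  qed
  then have "(\<integral>\<^sup>+x. ennreal \<bar>enn2real (mx D x) powr q - b powr q\<bar> * indicator Q x \<partial>lebesgue)
     \<le> (\<integral>\<^sup>+x. ennreal (enn2real (mx ?G x) powr q) * indicator Q x \<partial>lebesgue)"
    by (rule nn_integral_mono_AE)
  also have "\<dots> \<le> ennreal (kolmogorov_const q * t powr q * measure lebesgue Q)"
    by (rule mx_powr_integral[OF _ _ Q t q]) auto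
  finally show ?thesis by (rule that)
qed

text \<open>Almost everywhere \<open>w\<close> is at most the maximal function, so the reverse weak
  type estimate bounds the integral of \<open>w\<close> over {w > 2^k a} by C 2^k a times the
  measure of the superlevel set of \<open>mx D\<close>. Summing over k turns the left side into the
  logarithmic integral and the right side into at most 2 C times the integral of
  \<open>mx D\<close>.\<close>

lemma LlogL_of_mx_integrable:
  assumes fin: "(\<integral>\<^sup>+x. mx D x \<partial>lebesgue) < \<infinity>"
  shows "(\<integral>\<^sup>+x. ennreal (w x * max (ln (w x)) 0) \<partial>lebesgue) < \<infinity>"
proof -
  \<comment> \<open>The bound by 1 makes \<open>ln a\<close> nonnegative; the bound by the mean over
    \<open>Q\<^sub>0\<close> admits the reverse weak type estimate at every level 2^k a.\<close>
  define a where "a = max 1 (mean Q\<^sub>0)"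
  have a: "1 \<le> a" "mean Q\<^sub>0 \<le> a" by (auto simp: a_def)
  let ?E = "\<lambda>k. {x. ennreal (2 ^ k * a) < mx D x}"
  let ?W = "\<lambda>k::nat. {x. 2 ^ k * a < w x}"
  have [measurable]: "?E k \<in> sets lebesgue" for k by (rule set_superlevel) simp
  have [measurable]: "?W k \<in> sets lebesgue" for k
  proof -
    have "{x \<in> space lebesgue. 2 ^ k * a < w x} \<in> sets lebesgue" by measurable
    then show ?thesis by simp
  qed
  have level: "(\<integral>\<^sup>+x. ennreal (w x) * indicator (?W k) x \<partial>lebesgue)
      \<le> ennreal C * (\<integral>\<^sup>+x. ennreal (2 ^ k * a) * indicator (?E k) x \<partial>lebesgue)" for k
  proof -
    have "mean Q\<^sub>0 \<le> 2 ^ k * a"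
      using a mult_right_mono[of 1 "2 ^ k" a] by (simp add: order_trans[of _ a])
    note rev = mx_reverse_weak_type[OF this]
    have "(\<integral>\<^sup>+x. ennreal (w x) * indicator (?W k) x \<partial>lebesgue)
       \<le> (\<integral>\<^sup>+x. ennreal (w x) * indicator (?E k) x \<partial>lebesgue)"
    proof (rule nn_integral_mono_AE)
      show "AE x in lebesgue. ennreal (w x) * indicator (?W k) x \<le> ennreal (w x) * indicator (?E k) x"
        using weight_le_mx_AE
      proof eventually_elim
        case (elim x)
        have "x \<in> ?E k" if "x \<in> ?W k"
        proof -
          have "ennreal (2 ^ k * a) < ennreal (w x)"
            using that a by (simp add: ennreal_less_iff)
          with elim show ?thesis by simp
        qed
        then show ?case by (auto simp: indicator_def)
      qed
    qed
    also have "\<dots> = emeasure \<nu> (?E k)" by (rule emeasure_\<nu>[symmetric]) measurable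
    also note rev
    also have "ennreal (C * (2 ^ k * a)) * emeasure lebesgue (?E k)
       = ennreal C * (\<integral>\<^sup>+x. ennreal (2 ^ k * a) * indicator (?E k) x \<partial>lebesgue)"
      using doubling_nonneg a by (simp add: nn_integral_cmult ennreal_mult mult.assoc)
    finally show ?thesis .
  qed
  have "(\<integral>\<^sup>+x. ennreal (w x * max (ln (w x)) 0) \<partial>lebesgue)
     \<le> (\<integral>\<^sup>+x. ennreal (ln a) * ennreal (w x) +
        (\<Sum>k. ennreal (ln 2) * (ennreal (w x) * indicator (?W k) x)) \<partial>lebesgue)"
    using log_le_dyadic_levels[OF weight_nonneg a(1)]
    by (intro nn_integral_mono) (simp add: indicator_def)
  also have "\<dots> = (\<integral>\<^sup>+x. ennreal (ln a) * ennreal (w x) \<partial>lebesgue) +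
     (\<integral>\<^sup>+x. (\<Sum>k. ennreal (ln 2) * (ennreal (w x) * indicator (?W k) x)) \<partial>lebesgue)"
    by (rule nn_integral_add) measurable
  also have "(\<integral>\<^sup>+x. (\<Sum>k. ennreal (ln 2) * (ennreal (w x) * indicator (?W k) x)) \<partial>lebesgue)
     = (\<Sum>k. ennreal (ln 2) * (\<integral>\<^sup>+x. ennreal (w x) * indicator (?W k) x \<partial>lebesgue))"
    by (subst nn_integral_suminf) (simp_all add: nn_integral_cmult)
  also have "\<dots> \<le> (\<Sum>k. ennreal (ln 2) *
      (ennreal C * (\<integral>\<^sup>+x. ennreal (2 ^ k * a) * indicator (?E k) x \<partial>lebesgue)))"
    by (intro suminf_le mult_left_mono level) auto
  also have "\<dots> = ennreal (ln 2) * ennreal C *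
      (\<integral>\<^sup>+x. (\<Sum>k. ennreal (2 ^ k * a) * indicator (?E k) x) \<partial>lebesgue)"
    by (subst nn_integral_suminf) (simp_all add: mult.assoc)
  also have "(\<integral>\<^sup>+x. (\<Sum>k. ennreal (2 ^ k * a) * indicator (?E k) x) \<partial>lebesgue)
     \<le> (\<integral>\<^sup>+x. 2 * mx D x \<partial>lebesgue)"
  proof (rule nn_integral_mono)
    fix x
    have "0 < a" using a by simp
    from suminf_dyadic_levels[OF this, of "mx D x"]
    show "(\<Sum>k. ennreal (2 ^ k * a) * indicator (?E k) x) \<le> 2 * mx D x"
      by (simp add: indicator_def)
  qed
  also have "\<dots> = 2 * (\<integral>\<^sup>+x. mx D x \<partial>lebesgue)"
    using mx_measurable[OF subset_refl] by (rule nn_integral_cmult)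
  finally have bound: "(\<integral>\<^sup>+x. ennreal (w x * max (ln (w x)) 0) \<partial>lebesgue)
     \<le> (\<integral>\<^sup>+x. ennreal (ln a) * ennreal (w x) \<partial>lebesgue) +
       ennreal (ln 2) * ennreal C * (2 * (\<integral>\<^sup>+x. mx D x \<partial>lebesgue))"
    by (simp add: add_left_mono mult_left_mono)
  have "(\<integral>\<^sup>+x. ennreal (ln a) * ennreal (w x) \<partial>lebesgue) =
      ennreal (ln a) * ennreal (integral\<^sup>L lebesgue w)"
    by (simp add: nn_integral_cmult nn_integral_eq_integral[OF weight_integrable] weight_nonneg)
  then show ?thesis
    using fin by (intro le_less_trans[OF bound]) (auto simp: ennreal_mult_less_top less_top[symmetric] ennreal_mult_eq_top_iff)
qed

end

section \<open>The dyadic grid\<close>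

definition grid_cube :: "real ^ 'n \<Rightarrow> real \<Rightarrow> nat \<Rightarrow> ('n \<Rightarrow> nat) \<Rightarrow> (real ^ 'n) set" where
  "grid_cube a l j k =
     cbox (\<chi> i. a $ i + real (k i) * (l / 2 ^ j)) (\<chi> i. a $ i + (real (k i) + 1) * (l / 2 ^ j))"

lemma mem_grid_cube:
  "x \<in> grid_cube a l j k \<longleftrightarrow>
    (\<forall>i. a $ i + real (k i) * (l / 2 ^ j) \<le> x $ i \<and> x $ i \<le> a $ i + (real (k i) + 1) * (l / 2 ^ j))"
  by (simp add: grid_cube_def mem_box_cart)

lemma mem_interior_grid_cube:
  "x \<in> interior (grid_cube a l j k) \<longleftrightarrow>
    (\<forall>i. a $ i + real (k i) * (l / 2 ^ j) < x $ i \<and> x $ i < a $ i + (real (k i) + 1) * (l / 2 ^ j))"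
  by (simp add: grid_cube_def mem_box_cart)

text \<open>A nonempty box determines its corners, so the quantified corner and side length in
  \<open>dyadic_level\<close> can only be \<open>a\<close> and \<open>l\<close>.\<close>

lemma dyadic_subcubes_eq:
  fixes a :: "real ^ 'n"
  assumes "0 < l"
  shows "dyadic_subcubes (cbox a (\<chi> i. a $ i + l)) = {grid_cube a l j k | j k. \<forall>i. k i < 2 ^ j}"
proof -
  have "b = a \<and> m = l" if "cbox a (\<chi> i. a $ i + l) = cbox b (\<chi> i. b $ i + m)" for b :: "real ^ 'n" and m
  proof -
    have "a \<in> cbox a (\<chi> i. a $ i + l)"
      using assms by (simp add: mem_box_cart)
    with that have "a = b" "(\<chi> i. a $ i + l) = (\<chi> i. b $ i + m)"
      by (metis empty_iff eq_cbox)+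
    then show ?thesis by (auto simp: vec_eq_iff)
  qed
  then show ?thesis
    using assms unfolding dyadic_subcubes_def dyadic_level_def grid_cube_def by blast
qed

lemma measure_grid_cube:
  fixes a :: "real ^ 'n"
  assumes "0 < l"
  shows "measure lebesgue (grid_cube a l j k) = (l / 2 ^ j) ^ CARD('n)"
proof -
  have "grid_cube a l j k \<noteq> {}"
    unfolding grid_cube_def interval_ne_empty_cart using assms by (simp add: distrib_right divide_right_mono)
  then show ?thesis
    unfolding grid_cube_def by (simp add: content_cbox_cart distrib_right add_divide_distrib power_divide)
qed

text \<open>The level-j ancestor of the cube with index \<open>k'\<close> has index
  \<open>k' i div 2 ^ d\<close> in coordinate i. If these agree with \<open>k\<close>, the cubes are
  nested; if one differs, the projections to that coordinate meet at most in an endpoint.\<close>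

lemma grid_cube_nested:
  fixes a :: "real ^ 'n"
  assumes "0 < l" "j \<le> j'"
  shows "grid_cube a l j' k' \<subseteq> grid_cube a l j k \<or>
         interior (grid_cube a l j' k') \<inter> interior (grid_cube a l j k) = {}"
proof -
  define d where "d = j' - j"
  define h where "h = l / 2 ^ j'"
  have h: "0 < h" using assms by (simp add: h_def)
  have hj: "l / 2 ^ j = 2 ^ d * h"
    using assms by (simp add: h_def d_def power_diff)
  show ?thesis
  proof (cases "\<forall>i. k' i div 2 ^ d = k i")
    case True
    have "real (k i) * (2 ^ d * h) \<le> real (k' i) * h \<and>
          (real (k' i) + 1) * h \<le> (real (k i) + 1) * (2 ^ d * h)" for i
    proof -
      have "k i * 2 ^ d \<le> k' i"
        using True div_times_less_eq_dividend by metis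
      moreover have "k' i + 1 \<le> (k i + 1) * 2 ^ d"
        using True dividend_less_div_times[of "2 ^ d" "k' i"] by (simp add: Suc_leI)
      ultimately have "real (k i * 2 ^ d) \<le> real (k' i)" "real (k' i + 1) \<le> real ((k i + 1) * 2 ^ d)"
        by (simp_all only: of_nat_le_iff)
      then have "real (k i) * 2 ^ d \<le> real (k' i)" "real (k' i) + 1 \<le> (real (k i) + 1) * 2 ^ d"
        by (simp_all add: algebra_simps)
      with h show ?thesis
        using mult_right_mono[of "real (k i) * 2 ^ d" "real (k' i)" h]
          mult_right_mono[of "real (k' i) + 1" "(real (k i) + 1) * 2 ^ d" h]
        by (simp add: mult.assoc)
    qed
    then have "grid_cube a l j' k' \<subseteq> grid_cube a l j k"
      unfolding subset_iff mem_grid_cube hj h_def[symmetric]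
      by (meson add_left_mono order_trans)
    then show ?thesis by blast
  next
    case False
    then obtain i where i: "k' i div 2 ^ d \<noteq> k i" by blast
    have apart: "(real (k' i) + 1) * h \<le> real (k i) * (2 ^ d * h) \<or>
          (real (k i) + 1) * (2 ^ d * h) \<le> real (k' i) * h"
    proof (cases "k' i div 2 ^ d < k i")
      case True
      then have "k' i < k i * 2 ^ d" by (simp add: div_less_iff_less_mult)
      then have "real (k' i + 1) \<le> real (k i * 2 ^ d)"
        unfolding of_nat_le_iff by simp
      then have "real (k' i) + 1 \<le> real (k i) * 2 ^ d" by (simp add: algebra_simps)
      then show ?thesis
        using h mult_right_mono[of "real (k' i) + 1" "real (k i) * 2 ^ d" h] by (simp add: mult.assoc)
    next
      case False
      with i have "k i + 1 \<le> k' i div 2 ^ d" by simp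
      then have "(k i + 1) * 2 ^ d \<le> k' i" by (simp add: less_eq_div_iff_mult_less_eq)
      then have "real ((k i + 1) * 2 ^ d) \<le> real (k' i)"
        unfolding of_nat_le_iff .
      then have "(real (k i) + 1) * 2 ^ d \<le> real (k' i)" by (simp add: algebra_simps)
      then show ?thesis
        using h mult_right_mono[of "(real (k i) + 1) * 2 ^ d" "real (k' i)" h] by (simp add: mult.assoc)
    qed
    have "\<not> (x \<in> interior (grid_cube a l j' k') \<and> x \<in> interior (grid_cube a l j k))" for x
    proof (intro notI, elim conjE)
      assume "x \<in> interior (grid_cube a l j' k')" "x \<in> interior (grid_cube a l j k)"
      then have "a $ i + real (k' i) * h < x $ i" "x $ i < a $ i + (real (k' i) + 1) * h"
        "a $ i + real (k i) * (2 ^ d * h) < x $ i" "x $ i < a $ i + (real (k i) + 1) * (2 ^ d * h)"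
        unfolding mem_interior_grid_cube hj h_def[symmetric] by auto
      with apart show False by linarith
    qed
    then show ?thesis by blast
  qed
qed

text \<open>The floor of \<open>y\<close> works except at the right end y = N, where it is one too
  large; the last closed cell, with index N - 1, contains that point.\<close>

lemma grid_index_exists:
  fixes y :: real
  assumes "0 \<le> y" "y \<le> real N" "0 < N"
  shows "\<exists>k<N. real k \<le> y \<and> y \<le> real k + 1"
proof (cases "y < real N")
  case True
  have "real (nat \<lfloor>y\<rfloor>) = of_int \<lfloor>y\<rfloor>" using assms(1) by simp
  moreover from this True have "nat \<lfloor>y\<rfloor> < N"
    by (simp flip: of_nat_less_iff[where 'a=real]) linarith
  ultimately show ?thesis
    by (intro exI[of _ "nat \<lfloor>y\<rfloor>"]) linarith
next
  case False
  then show ?thesis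
    using assms by (intro exI[of _ "N - 1"]) (auto simp: of_nat_diff)
qed

lemma grid_cube_fine:
  fixes a :: "real ^ 'n"
  assumes "0 < l" "open U" "x \<in> U" "x \<in> cbox a (\<chi> i. a $ i + l)"
  shows "\<exists>j k. (\<forall>i. k i < 2 ^ j) \<and> x \<in> grid_cube a l j k \<and> grid_cube a l j k \<subseteq> U"
proof -
  obtain e where e: "0 < e" "ball x e \<subseteq> U"
    using assms(2,3) openE by blast
  \<comment> \<open>Points of one grid cube differ by at most the side length in each coordinate, so
    the l1 norm bounds their distance by dimension times side length; \<open>j\<close> makes this
    less than \<open>e\<close>.\<close>
  obtain j where j: "real CARD('n) * l / e < 2 ^ j"
    using real_arch_pow[of 2 "real CARD('n) * l / e"] by auto
  define h where "h = l / 2 ^ j"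
  have h: "0 < h" using assms by (simp add: h_def)
  have small: "real CARD('n) * h < e"
    using j e(1) by (simp add: h_def field_simps)
  have "\<exists>k<2 ^ j. real k * h \<le> x $ i - a $ i \<and> x $ i - a $ i \<le> (real k + 1) * h" for i
  proof -
    have xi: "0 \<le> x $ i - a $ i" "x $ i - a $ i \<le> l"
      using assms(4) by (auto simp: mem_box_cart algebra_simps)
    then have "(x $ i - a $ i) / h \<le> real (2 ^ j)"
      using h by (simp add: pos_divide_le_eq) (simp add: h_def)
    then show ?thesis
      using grid_index_exists[of "(x $ i - a $ i) / h" "2 ^ j"] xi h
      by (simp add: pos_le_divide_eq pos_divide_le_eq)
  qed
  then obtain k where k: "\<And>i. k i < 2 ^ j \<and> real (k i) * h \<le> x $ i - a $ i \<and> x $ i - a $ i \<le> (real (k i) + 1) * h"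
    by metis
  have "x \<in> grid_cube a l j k"
    unfolding mem_grid_cube h_def[symmetric]
  proof
    fix i
    show "a $ i + real (k i) * h \<le> x $ i \<and> x $ i \<le> a $ i + (real (k i) + 1) * h"
      using k[of i] by linarith
  qed
  moreover have "grid_cube a l j k \<subseteq> ball x e"
  proof
    fix z assume z: "z \<in> grid_cube a l j k"
    have "norm (z - x) \<le> (\<Sum>i\<in>UNIV. \<bar>(z - x) $ i\<bar>)" by (rule norm_le_l1_cart)
    also have "\<dots> \<le> (\<Sum>i\<in>(UNIV :: 'n set). h)"
    proof (rule sum_mono)
      fix i
      have "real (k i) * h \<le> z $ i - a $ i" "z $ i - a $ i \<le> real (k i) * h + h"
        using z unfolding mem_grid_cube h_def[symmetric] by (simp_all add: algebra_simps)
      moreover have "real (k i) * h \<le> x $ i - a $ i" "x $ i - a $ i \<le> real (k i) * h + h"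
        using k[of i] by (simp_all add: algebra_simps)
      ultimately show "\<bar>(z - x) $ i\<bar> \<le> h" by simp
    qed
    also have "\<dots> < e" using small by simp
    finally show "z \<in> ball x e" by (simp add: dist_norm norm_minus_commute)
  qed
  ultimately show ?thesis using k e(2) by blast
qed

lemma dyadic_family_subcubes:
  fixes Q\<^sub>0 :: "(real ^ 'n) set"
  assumes "cube Q\<^sub>0"
  shows "dyadic_family (dyadic_subcubes Q\<^sub>0) Q\<^sub>0 (2 ^ CARD('n))"
proof -
  from assms obtain a l where l: "0 < l" and Q0: "Q\<^sub>0 = cbox a (\<chi> i. a $ i + l)"
    unfolding cube_def by blast
  let ?G = "grid_cube a l"
  have D: "dyadic_subcubes Q\<^sub>0 = {?G j k | j k. \<forall>i. k i < 2 ^ j}"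
    unfolding Q0 by (rule dyadic_subcubes_eq[OF l])
  have top: "Q\<^sub>0 = ?G 0 (\<lambda>_. 0)"
    by (simp add: Q0 grid_cube_def)
  show ?thesis
  proof
    show "countable (dyadic_subcubes Q\<^sub>0)"
      unfolding D by (rule countable_subset[of _ "range (\<lambda>(j, k). ?G j k)"]) auto
    show "(0::real) \<le> 2 ^ CARD('n)" by simp
    show "Q\<^sub>0 \<in> dyadic_subcubes Q\<^sub>0"
      unfolding D using top by (intro CollectI exI[of _ 0] exI[of _ "\<lambda>_. 0"] conjI) simp_all
  next
    fix A assume "A \<in> dyadic_subcubes Q\<^sub>0"
    then obtain j k where A: "A = ?G j k" "\<And>i. k i < 2 ^ j" unfolding D by blast
    show "A \<subseteq> Q\<^sub>0"
    proof -
      have "(real (k i) + 1) * (l / 2 ^ j) \<le> l" for i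
      proof -
        have "real (k i + 1) \<le> real (2 ^ j)"
          using A(2)[of i] unfolding of_nat_le_iff by simp
        then have "(real (k i) + 1) * l \<le> 2 ^ j * l"
          using l by (intro mult_right_mono) simp_all
        then show ?thesis by (simp add: pos_divide_le_eq mult.commute)
      qed
      moreover have "0 \<le> real (k i) * (l / 2 ^ j)" for i using l by simp
      ultimately show ?thesis
        unfolding A(1) Q0 grid_cube_def by (simp add: subset_interval_cart)
    qed
    show "compact A" by (simp add: A grid_cube_def)
    show "0 < measure lebesgue A" using l by (simp add: A measure_grid_cube)
    show "negligible (frontier A)"
      unfolding A(1) grid_cube_def by (intro negligible_convex_frontier convex_box)
    show "finite {B \<in> dyadic_subcubes Q\<^sub>0. A \<subseteq> B}"
    proof (rule finite_subset)
      show "finite ((\<lambda>(j, k). ?G j k) ` (SIGMA i:{..j}. {k. \<forall>x. k x < 2 ^ i}))"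
      proof (intro finite_imageI finite_SigmaI finite_atMost)
        fix i
        have "finite {k :: 'n \<Rightarrow> nat. \<forall>x. (x \<in> UNIV \<longrightarrow> k x \<in> {..<2 ^ i}) \<and> (x \<notin> UNIV \<longrightarrow> k x = 0)}"
          by (rule finite_set_of_finite_funs) auto
        then show "finite {k :: 'n \<Rightarrow> nat. \<forall>x. k x < 2 ^ i}" by simp
      qed
      \<comment> \<open>A cube of a finer level has smaller measure and cannot contain
        \<open>A\<close>, so ancestors come from levels up to \<open>j\<close>, each with finitely
        many indices.\<close>
      have "j' \<le> j" if "A \<subseteq> ?G j' k'" for j' k'
      proof (rule ccontr)
        assume "\<not> j' \<le> j"
        then have "l / 2 ^ j' < l / 2 ^ j"
          using l by (intro divide_strict_left_mono power_strict_increasing) auto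
        then have "(l / 2 ^ j') ^ CARD('n) < (l / 2 ^ j) ^ CARD('n)"
          using l by (intro power_strict_mono) auto
        moreover have "measure lebesgue A \<le> measure lebesgue (?G j' k')"
          using that by (intro measure_mono_fmeasurable) (auto simp: A grid_cube_def)
        ultimately show False by (simp add: A measure_grid_cube[OF l])
      qed
      then show "{B \<in> dyadic_subcubes Q\<^sub>0. A \<subseteq> B}
          \<subseteq> (\<lambda>(j, k). ?G j k) ` (SIGMA i:{..j}. {k. \<forall>x. k x < 2 ^ i})"
        unfolding D by fastforce
    qed
    show "\<exists>B\<in>dyadic_subcubes Q\<^sub>0. A \<subset> B \<and> measure lebesgue B \<le> 2 ^ CARD('n) * measure lebesgue A"
      if "A \<noteq> Q\<^sub>0"
    proof -
      have "j \<noteq> 0"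
      proof
        assume "j = 0"
        then have "k = (\<lambda>_. 0)" using A(2) by auto
        with \<open>j = 0\<close> that A(1) top show False by simp
      qed
      \<comment> \<open>The parent is one level up, with every index halved. Its measure is exactly
        2 to the dimension times that of \<open>A\<close>, which also makes the inclusion
        strict.\<close>
      then obtain i where j: "j = Suc i" using not0_implies_Suc by blast
      let ?k = "\<lambda>x. k x div 2"
      have "?G i ?k \<in> dyadic_subcubes Q\<^sub>0"
      proof -
        have "?k x < 2 ^ i" for x using A(2)[of x] j by (simp add: less_mult_imp_div_less mult.commute)
        then show ?thesis unfolding D by blast
      qed
      moreover have sub: "A \<subseteq> ?G i ?k"
        unfolding A(1) j subset_iff mem_grid_cube
      proof (intro allI impI)
        fix x x' i'
        assume x: "\<forall>x'. a $ x' + real (k x') * (l / 2 ^ Suc i) \<le> x $ x' \<and>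
                 x $ x' \<le> a $ x' + (real (k x') + 1) * (l / 2 ^ Suc i)"
        define h where "h = l / 2 ^ Suc i"
        have h: "0 < h" "l / 2 ^ i = 2 * h" using l by (auto simp: h_def)
        have "k i' div 2 * 2 \<le> k i'" "k i' + 1 \<le> (k i' div 2 + 1) * 2" by arith+
        then have "real (k i' div 2 * 2) \<le> real (k i')" "real (k i' + 1) \<le> real ((k i' div 2 + 1) * 2)"
          by (simp_all only: of_nat_le_iff)
        then have "real (k i' div 2) * 2 \<le> real (k i')" "real (k i') + 1 \<le> (real (k i' div 2) + 1) * 2"
          by (simp_all add: algebra_simps)
        then have "real (k i' div 2) * 2 * h \<le> real (k i') * h"
          "(real (k i') + 1) * h \<le> (real (k i' div 2) + 1) * 2 * h"
          using h(1) by (intro mult_right_mono; simp)+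
        then show "a $ i' + real (k i' div 2) * (l / 2 ^ i) \<le> x $ i' \<and>
            x $ i' \<le> a $ i' + (real (k i' div 2) + 1) * (l / 2 ^ i)"
          using x[rule_format, of i'] unfolding h(2) h_def[symmetric] mult.assoc by linarith
      qed
      moreover have double: "measure lebesgue (?G i ?k) = 2 ^ CARD('n) * measure lebesgue A"
        using l by (simp add: A(1) j measure_grid_cube power_mult_distrib[symmetric])
      moreover have "A \<noteq> ?G i ?k"
      proof
        assume "A = ?G i ?k"
        with double have "(2 ^ CARD('n) - 1) * measure lebesgue A = 0" by (simp add: algebra_simps)
        moreover have "(1::real) < 2 ^ CARD('n)" by (rule one_less_power) auto
        moreover have "0 < measure lebesgue A" using l by (simp add: A measure_grid_cube)
        ultimately show False by auto
      qed
      ultimately show ?thesis by (intro bexI[of _ "?G i ?k"]) auto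
    qed
  next
    fix A B assume "A \<in> dyadic_subcubes Q\<^sub>0" "B \<in> dyadic_subcubes Q\<^sub>0"
    then obtain j k j' k' where "A = ?G j k" "B = ?G j' k'" unfolding D by blast
    then show "A \<subseteq> B \<or> B \<subseteq> A \<or> interior A \<inter> interior B = {}"
      using grid_cube_nested[OF l, of j j' a k' k] grid_cube_nested[OF l, of j' j a k k']
      by (cases "j \<le> j'") auto
  next
    fix U x assume "open U" "x \<in> U" "x \<in> Q\<^sub>0"
    then obtain j k where jk: "\<forall>i. k i < 2 ^ j" "x \<in> ?G j k" "?G j k \<subseteq> U"
      using grid_cube_fine[OF l, of U x a] unfolding Q0 by auto
    then have "?G j k \<in> dyadic_subcubes Q\<^sub>0" unfolding D by auto
    with jk show "\<exists>A\<in>dyadic_subcubes Q\<^sub>0. x \<in> A \<and> A \<subseteq> U" by blast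
  qed
qed

section \<open>Mean oscillation\<close>

lemma integrable_lebesgue_on_subset:
  fixes h :: "'a::euclidean_space \<Rightarrow> real"
  assumes "integrable (lebesgue_on S) h" "S \<in> sets lebesgue" "T \<in> sets lebesgue" "T \<subseteq> S"
  shows "integrable (lebesgue_on T) h"
  using assms set_integrable_subset[of lebesgue S h T]
  by (simp add: set_integrable_def integrable_restrict_space)

text \<open>The average of \<open>g\<close> is within the mean of \<bar>g - c\<bar> of any constant
  \<open>c\<close>, so centring at \<open>c\<close> instead costs a factor of at most 2.\<close>

lemma average_osc_le:
  fixes g :: "real ^ 'n \<Rightarrow> real"
  assumes g: "integrable (lebesgue_on Q) g" and Q: "Q \<in> lmeasurable" "0 < measure lebesgue Q"
  shows "average Q (\<lambda>x. \<bar>g x - average Q g\<bar>) \<le> 2 * average Q (\<lambda>x. \<bar>g x - c\<bar>)"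
proof -
  let ?M = "lebesgue_on Q" and ?m = "measure lebesgue Q"
  have fin: "finite_measure ?M"
    using Q(1) by (rule finite_measure_lebesgue_on)
  have const: "integrable ?M (\<lambda>_. d)" for d :: real
    using fin by (rule finite_measure.integrable_const)
  have space: "measure ?M Q = ?m"
    using Q(1) by (subst measure_restrict_space) (auto dest: fmeasurableD)
  have int: "integrable ?M (\<lambda>x. \<bar>g x - d\<bar>)" for d
    by (intro integrable_abs Bochner_Integration.integrable_diff g const)
  have LINT_const: "(LINT x|?M. d) = ?m * d" for d :: real
    by (simp add: space)
  have "\<bar>average Q g - c\<bar> = \<bar>average Q (\<lambda>x. g x - c)\<bar>"
    using Q(2) by (simp add: average_def Bochner_Integration.integral_diff[OF g const] space right_diff_distrib)
  also have "\<dots> \<le> average Q (\<lambda>x. \<bar>g x - c\<bar>)"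
    unfolding average_def abs_mult
    using integral_abs_bound[of ?M "\<lambda>x. g x - c"] Q(2) by (auto intro!: divide_right_mono)
  finally have mean: "\<bar>average Q g - c\<bar> \<le> average Q (\<lambda>x. \<bar>g x - c\<bar>)" .
  have "(LINT x|?M. \<bar>g x - average Q g\<bar>) \<le> (LINT x|?M. \<bar>g x - c\<bar> + \<bar>average Q g - c\<bar>)"
    by (intro integral_mono int Bochner_Integration.integrable_add const) linarith
  also have "\<dots> = (LINT x|?M. \<bar>g x - c\<bar>) + ?m * \<bar>average Q g - c\<bar>"
    by (simp only: Bochner_Integration.integral_add[OF int const] LINT_const)
  finally have "average Q (\<lambda>x. \<bar>g x - average Q g\<bar>)
      \<le> 1 / ?m * ((LINT x|?M. \<bar>g x - c\<bar>) + ?m * \<bar>average Q g - c\<bar>)"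
    unfolding average_def[of Q "\<lambda>x. \<bar>g x - average Q g\<bar>"] using Q(2) by (intro mult_left_mono) auto
  also have "\<dots> = average Q (\<lambda>x. \<bar>g x - c\<bar>) + \<bar>average Q g - c\<bar>"
    using Q(2) by (simp add: average_def distrib_left)
  finally show ?thesis using mean by linarith
qed

section \<open>Summation of oscillations over disjoint cubes\<close>

context dyadic_family
begin

lemma sum_emeasure_le:
  assumes F: "finite \<F>" "\<F> \<subseteq> D" "pairwise (\<lambda>A B. interior A \<inter> interior B = {}) \<F>"
    and \<alpha>: "sets \<alpha> = sets lebesgue" "absolutely_continuous lebesgue \<alpha>"
  shows "(\<Sum>A\<in>\<F>. emeasure \<alpha> A) \<le> emeasure \<alpha> Q\<^sub>0"
proof -
  have "(\<Sum>A\<in>\<F>. emeasure \<alpha> A) = (\<Sum>A\<in>\<F>. emeasure \<alpha> (interior A))"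
    using emeasure_interior_Union[of "{_}", OF _ \<alpha>] F(2) by (intro sum.cong) (auto simp: subset_iff)
  also have "\<dots> = emeasure \<alpha> (\<Union>A\<in>\<F>. interior A)"
    using F by (intro sum_emeasure) (auto simp: \<alpha>(1) lebesgue_open disjoint_family_on_def pairwise_def)
  also have "\<dots> \<le> emeasure \<alpha> Q\<^sub>0"
    using F(2) subset_top interior_subset sets_D[OF top_in_D] by (intro emeasure_mono) (auto simp: \<alpha>(1), blast)
  finally show ?thesis .
qed

end

locale dyadic_cube_weight = dyadic_weight D Q\<^sub>0 C w
  for D :: "(real ^ 'n) set set" and Q\<^sub>0 C w
begin

text \<open>Kolmogorov's inequality on \<open>Q\<^sub>0\<close> with the whole family
  \<open>D\<close> gives integrability there, which restricts to every smaller cube.\<close>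

lemma mx_powr_integrable:
  assumes q: "0 < q" "q < 1" and Q: "Q \<in> D"
  shows "integrable (lebesgue_on Q) (\<lambda>x. enn2real (mx D x) powr q)"
proof -
  let ?g = "\<lambda>x. enn2real (mx D x) powr q"
  have [measurable]: "mx D \<in> borel_measurable lebesgue" by (rule mx_measurable) simp
  have "integrable (lebesgue_on Q\<^sub>0) ?g"
  proof (rule integrableI_bounded)
    show "?g \<in> borel_measurable (lebesgue_on Q\<^sub>0)"
      by (rule measurable_restrict_space1) measurable
    have "(\<integral>\<^sup>+x. ennreal (norm (?g x)) \<partial>lebesgue_on Q\<^sub>0)
        = (\<integral>\<^sup>+x. ennreal (?g x) * indicator Q\<^sub>0 x \<partial>lebesgue)"
      using sets_D[OF top_in_D] by (subst nn_integral_restrict_space) auto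
    also have "\<dots> \<le> ennreal (kolmogorov_const q * (mean Q\<^sub>0 + 1) powr q * measure lebesgue Q\<^sub>0)"
      using subset_top q mean_nonneg[of Q\<^sub>0] by (intro mx_powr_integral top_in_D) auto
    also have "\<dots> < \<infinity>" by simp
    finally show "(\<integral>\<^sup>+x. ennreal (norm (?g x)) \<partial>lebesgue_on Q\<^sub>0) < \<infinity>" .
  qed
  then show ?thesis
    by (rule integrable_lebesgue_on_subset[OF _ sets_D[OF top_in_D] sets_D[OF Q] subset_top[OF Q]])
qed

text \<open>The additive term \<open>measure lebesgue Q\<close> comes from using the level \<open>mean Q + 1\<close>, which is positive
  even where the weight vanishes; it still sums over disjoint cubes.\<close>

lemma JN_term_le:
  fixes p :: real
  assumes p: "1 < p" and Q: "Q \<in> D"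
  defines "g \<equiv> \<lambda>x. enn2real (mx D x) powr (1 / p)"
  shows "measure lebesgue Q * average Q (\<lambda>x. \<bar>g x - average Q g\<bar>) powr p
    \<le> (2 * kolmogorov_const (1 / p)) powr p * (measure \<nu> Q + measure lebesgue Q)"
proof -
  let ?m = "measure lebesgue Q" and ?K = "kolmogorov_const (1 / p)" and ?t = "mean Q + 1"
  have q: "0 < 1 / p" "1 / p < 1" using p by auto
  have t: "0 < ?t" "mean Q \<le> ?t" using mean_nonneg[of Q] by auto
  have m: "0 < ?m" by (rule measure_pos[OF Q])
  have K: "0 \<le> ?K" using q(2) by (rule kolmogorov_const_nonneg)
  have g: "integrable (lebesgue_on Q) g"
    unfolding g_def by (rule mx_powr_integrable[OF q Q])
  obtain c where c: "(\<integral>\<^sup>+x. ennreal \<bar>g x - c\<bar> * indicator Q x \<partial>lebesgue) \<le> ennreal (?K * ?t powr (1 / p) * ?m)"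
    unfolding g_def using mx_powr_oscillation[OF Q t q] by blast
  have const: "integrable (lebesgue_on Q) (\<lambda>_. c)"
    using finite_measure_lebesgue_on[OF lmeasurable_D[OF Q]] by (rule finite_measure.integrable_const)
  have "ennreal (LINT x|lebesgue_on Q. \<bar>g x - c\<bar>) = (\<integral>\<^sup>+x. ennreal \<bar>g x - c\<bar> \<partial>lebesgue_on Q)"
    by (intro nn_integral_eq_integral[symmetric] integrable_abs Bochner_Integration.integrable_diff g const) simp
  also have "\<dots> = (\<integral>\<^sup>+x. ennreal \<bar>g x - c\<bar> * indicator Q x \<partial>lebesgue)"
    using sets_D[OF Q] by (subst nn_integral_restrict_space) auto
  also note c
  finally have "(LINT x|lebesgue_on Q. \<bar>g x - c\<bar>) \<le> ?K * ?t powr (1 / p) * ?m"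
    using K m by simp
  then have "average Q (\<lambda>x. \<bar>g x - c\<bar>) \<le> ?K * ?t powr (1 / p)"
    using m by (simp add: average_def pos_divide_le_eq)
  then have "average Q (\<lambda>x. \<bar>g x - average Q g\<bar>) \<le> 2 * ?K * ?t powr (1 / p)"
    using average_osc_le[OF g lmeasurable_D[OF Q] m, of c] by linarith
  moreover have "0 \<le> average Q (\<lambda>x. \<bar>g x - average Q g\<bar>)"
    by (simp add: average_def)
  ultimately have "average Q (\<lambda>x. \<bar>g x - average Q g\<bar>) powr p \<le> (2 * ?K * ?t powr (1 / p)) powr p"
    using p by (intro powr_mono2) auto
  \<comment> \<open>The exponents 1/p and p cancel, so the bound is linear in the mean; multiplied
    by \<bar>Q\<bar> it becomes a sum of two measures of \<open>Q\<close>, additive over disjoint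
    cubes.\<close>
  also have "\<dots> = (2 * ?K) powr p * ?t"
    using K p t by (simp add: powr_mult powr_powr)
  finally have "?m * average Q (\<lambda>x. \<bar>g x - average Q g\<bar>) powr p \<le> ?m * ((2 * ?K) powr p * ?t)"
    using m by (intro mult_left_mono) auto
  also have "\<dots> = (2 * ?K) powr p * (measure \<nu> Q + ?m)"
    using m by (simp add: mean_def field_simps)
  finally show ?thesis .
qed

lemma JN_sum_le:
  fixes p :: real
  assumes p: "1 < p" and \<F>: "\<F> \<subseteq> D" "pairwise (\<lambda>A B. interior A \<inter> interior B = {}) \<F>"
  defines "g \<equiv> \<lambda>x. enn2real (mx D x) powr (1 / p)"
  shows "(\<Sum>\<^sub>\<infinity>Q\<in>\<F>. ennreal (measure lebesgue Q * average Q (\<lambda>x. \<bar>g x - average Q g\<bar>) powr p))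
    \<le> ennreal ((2 * kolmogorov_const (1 / p)) powr p) * (emeasure \<nu> Q\<^sub>0 + emeasure lebesgue Q\<^sub>0)"
\<comment> \<open>A sum of nonnegative terms is the supremum of its finite partial sums, so a bound
  uniform over finite subfamilies is enough.\<close>
proof (subst nonneg_infsum_complete, simp, rule SUP_least)
  let ?c = "ennreal ((2 * kolmogorov_const (1 / p)) powr p)"
  fix F assume "F \<in> {F. finite F \<and> F \<subseteq> \<F>}"
  then have F: "finite F" "F \<subseteq> D" "pairwise (\<lambda>A B. interior A \<inter> interior B = {}) F"
    using \<F> pairwise_subset by auto
  have "(\<Sum>Q\<in>F. ennreal (measure lebesgue Q * average Q (\<lambda>x. \<bar>g x - average Q g\<bar>) powr p))
     \<le> (\<Sum>Q\<in>F. ?c * (emeasure \<nu> Q + emeasure lebesgue Q))"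
  proof (rule sum_mono)
    fix Q assume "Q \<in> F"
    with F have Q: "Q \<in> D" by blast
    have "ennreal (measure lebesgue Q * average Q (\<lambda>x. \<bar>g x - average Q g\<bar>) powr p)
       \<le> ennreal ((2 * kolmogorov_const (1 / p)) powr p * (measure \<nu> Q + measure lebesgue Q))"
      unfolding g_def by (intro ennreal_leI JN_term_le[OF p Q])
    also have "\<dots> = ?c * (emeasure \<nu> Q + emeasure lebesgue Q)"
      by (simp add: ennreal_mult emeasure_eq_measure_\<nu> emeasure_D[OF Q])
    finally show "ennreal (measure lebesgue Q * average Q (\<lambda>x. \<bar>g x - average Q g\<bar>) powr p)
       \<le> ?c * (emeasure \<nu> Q + emeasure lebesgue Q)" .
  qed
  also have "\<dots> = ?c * ((\<Sum>Q\<in>F. emeasure \<nu> Q) + (\<Sum>Q\<in>F. emeasure lebesgue Q))"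
    by (simp add: sum_distrib_left[symmetric] sum.distrib)
  also have "\<dots> \<le> ?c * (emeasure \<nu> Q\<^sub>0 + emeasure lebesgue Q\<^sub>0)"
    by (intro mult_left_mono add_mono sum_emeasure_le F)
       (simp_all add: ac_\<nu>, simp add: absolutely_continuous_def)
  finally show "(\<Sum>Q\<in>F. ennreal (measure lebesgue Q * average Q (\<lambda>x. \<bar>g x - average Q g\<bar>) powr p))
     \<le> ?c * (emeasure \<nu> Q\<^sub>0 + emeasure lebesgue Q\<^sub>0)" .
qed

end

section \<open>Application to the weight \<bar>f\<bar> on the cube\<close>

theorem corollary4p4:
  fixes p :: real and Q\<^sub>0 :: "(real ^ 'n) set" and f :: "real ^ 'n \<Rightarrow> real"
  assumes "1 < p"
    and "cube Q\<^sub>0"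
    and "f \<in> L1_space Q\<^sub>0 - LlogL_space Q\<^sub>0"
  shows "(AE x in lebesgue_on Q\<^sub>0. dyadic_maximal Q\<^sub>0 f x < \<infinity>) \<and>
         (\<lambda>x. enn2real (dyadic_maximal Q\<^sub>0 f x) powr (1 / p)) \<in> JNd_space p Q\<^sub>0 - Lp_space p Q\<^sub>0"
proof -
  define w where "w x = \<bar>f x\<bar> * indicator Q\<^sub>0 x" for x
  let ?D = "dyadic_subcubes Q\<^sub>0"
  interpret dyadic_family ?D Q\<^sub>0 "2 ^ CARD('n)"
    using assms(2) by (rule dyadic_family_subcubes)
  have Q0[measurable]: "Q\<^sub>0 \<in> sets lebesgue" by (rule sets_D[OF top_in_D])
  have f: "integrable (lebesgue_on Q\<^sub>0) f" "f \<notin> LlogL_space Q\<^sub>0"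
    using assms(3) by (auto simp: L1_space_def)
  interpret dyadic_cube_weight ?D Q\<^sub>0 "2 ^ CARD('n)" w
  proof
    show "0 \<le> w x" for x by (simp add: w_def)
    show "w x = 0" if "x \<notin> Q\<^sub>0" for x using that by (simp add: w_def)
    have "integrable lebesgue (\<lambda>x. indicator Q\<^sub>0 x *\<^sub>R \<bar>f x\<bar>)"
      using integrable_abs[OF f(1)] integrable_restrict_space[of Q\<^sub>0 lebesgue "\<lambda>x. \<bar>f x\<bar>"] Q0 by simp
    then show "integrable lebesgue w" by (simp add: w_def[abs_def] mult.commute)
  qed
  have average_eq: "average A (\<lambda>y. \<bar>f y\<bar>) = mean A" if A: "A \<in> ?D" for A
  proof -
    have [measurable]: "A \<in> sets lebesgue" by (rule sets_D[OF A])
    have int: "integrable (lebesgue_on A) (\<lambda>x. \<bar>f x\<bar>)"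
      by (rule integrable_lebesgue_on_subset[OF integrable_abs[OF f(1)] Q0 sets_D[OF A] subset_top[OF A]])
    have "ennreal (measure \<nu> A) = (\<integral>\<^sup>+x. ennreal (w x) * indicator A x \<partial>lebesgue)"
      by (simp add: emeasure_eq_measure_\<nu>[symmetric] emeasure_\<nu>)
    also have "\<dots> = (\<integral>\<^sup>+x. ennreal \<bar>f x\<bar> * indicator A x \<partial>lebesgue)"
      using subset_top[OF A] by (intro nn_integral_cong) (auto simp: w_def indicator_def)
    also have "\<dots> = (\<integral>\<^sup>+x. ennreal \<bar>f x\<bar> \<partial>lebesgue_on A)"
      by (subst nn_integral_restrict_space) auto
    also have "\<dots> = ennreal (LINT x|lebesgue_on A. \<bar>f x\<bar>)"
      by (rule nn_integral_eq_integral[OF int]) simp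
    finally have "measure \<nu> A = (LINT x|lebesgue_on A. \<bar>f x\<bar>)" by simp
    then show ?thesis by (simp add: average_def mean_def)
  qed
  have max_eq: "dyadic_maximal Q\<^sub>0 f = mx ?D"
    unfolding dyadic_maximal_def mx_def by (intro ext SUP_cong) (auto simp: average_eq)
  let ?g = "\<lambda>x. enn2real (mx ?D x) powr (1 / p)"
  have q: "0 < 1 / p" "1 / p < 1" using assms(1) by auto
  have "?g \<in> JNd_space p Q\<^sub>0"
  proof -
    have "JNd_norm_pow p Q\<^sub>0 ?g
      \<le> ennreal ((2 * kolmogorov_const (1 / p)) powr p) * (emeasure \<nu> Q\<^sub>0 + emeasure lebesgue Q\<^sub>0)"
      unfolding JNd_norm_pow_def by (rule SUP_least) (use JN_sum_le[OF assms(1)] in blast)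
    also have "\<dots> < \<infinity>"
      by (simp add: emeasure_eq_measure_\<nu> emeasure_D[OF top_in_D] ennreal_mult_less_top)
    finally show ?thesis
      using mx_powr_integrable[OF q top_in_D] by (simp add: JNd_space_def L1_space_def)
  qed
  moreover have "?g \<notin> Lp_space p Q\<^sub>0"
  proof
    assume "?g \<in> Lp_space p Q\<^sub>0"
    \<comment> \<open>The p-th power of \<open>?g\<close> is the maximal function itself, so this
      would make the maximal function integrable and force \<open>f\<close> into the excluded
      space.\<close>
    then have "(\<integral>\<^sup>+x. ennreal (\<bar>?g x\<bar> powr p) \<partial>lebesgue_on Q\<^sub>0) < \<infinity>"
      by (simp add: Lp_space_def)
    also have "(\<integral>\<^sup>+x. ennreal (\<bar>?g x\<bar> powr p) \<partial>lebesgue_on Q\<^sub>0)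
        = (\<integral>\<^sup>+x. ennreal (enn2real (mx ?D x)) * indicator Q\<^sub>0 x \<partial>lebesgue)"
      using assms(1) by (subst nn_integral_restrict_space) (simp_all add: powr_powr)
    also have "\<dots> = (\<integral>\<^sup>+x. mx ?D x \<partial>lebesgue)"
    proof (rule nn_integral_cong_AE)
      show "AE x in lebesgue. ennreal (enn2real (mx ?D x)) * indicator Q\<^sub>0 x = mx ?D x"
        using mx_finite_AE
      proof eventually_elim
        case (elim x)
        show ?case
        proof (cases "x \<in> Q\<^sub>0")
          case False
          then have none: "{A \<in> ?D. x \<in> A} = {}" using subset_top by blast
          have "mx ?D x = 0" unfolding mx_def none by (simp add: bot_ennreal)
          with False show ?thesis by simp
        qed (use elim in simp)
      qed
    qed
    finally have "(\<integral>\<^sup>+x. ennreal (w x * max (ln (w x)) 0) \<partial>lebesgue) < \<infinity>"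
      by (rule LlogL_of_mx_integrable)
    also have "(\<integral>\<^sup>+x. ennreal (w x * max (ln (w x)) 0) \<partial>lebesgue)
      = (\<integral>\<^sup>+x. ennreal (\<bar>f x\<bar> * max (ln \<bar>f x\<bar>) 0) * indicator Q\<^sub>0 x \<partial>lebesgue)"
      by (intro nn_integral_cong) (simp add: w_def indicator_def)
    also have "\<dots> = (\<integral>\<^sup>+x. ennreal (\<bar>f x\<bar> * max (ln \<bar>f x\<bar>) 0) \<partial>lebesgue_on Q\<^sub>0)"
      by (subst nn_integral_restrict_space) auto
    finally have "f \<in> LlogL_space Q\<^sub>0"
      using f(1) by (simp add: LlogL_space_def borel_measurable_integrable)
    with f(2) show False by blast
  qed
  moreover have "AE x in lebesgue_on Q\<^sub>0. mx ?D x < \<infinity>"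
    using mx_finite_AE by (subst AE_restrict_space_iff) auto
  ultimately show ?thesis unfolding max_eq by blast
qed

end
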